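(* Let $\Gamma_1,\Gamma_2,\Gamma_3,\ldots:I^2\to[0,1]$ be a sequence of graphons. Then there exist a sequence $k_1<k_2<k_3<\cdots$ of natural numbers, versions $\Gamma'_{k_1},\Gamma'_{k_2},\Gamma'_{k_3},\ldots$ of $\Gamma_{k_1},\Gamma_{k_2},\Gamma_{k_3},\ldots$, and a graphon $W:I^2\to[0,1]$ such that the sequence $\Gamma'_{k_1},\Gamma'_{k_2},\Gamma'_{k_3},\ldots$ converges to $W$ in the cut-norm.
   Context: $I=[0,1]$ with Lebesgue measure. A graphon is a symmetric Lebesgue measurable function $I^2\to[0,1]$. A measurable $\gamma:I\to I$ is an almost-bijection if there are conull sets $J_1,J_2\subset I$ such that $\gamma|_{J_1}$ is a bijection of $J_1$ onto $J_2$; $\gamma^{-1}$ denotes $(\gamma|_{J_1})^{-1}$. A graphon $\Gamma'$ is a version of a graphon $\Gamma$ if there is a measure preserving almost-bijection $\gamma:I\to I$ with $\Gamma'(x,y)=\Gamma(\gamma^{-1}(x),\gamma^{-1}(y))$ for almost every $(x,y)\in I^2$. The cut-norm is $\|U\|_\square=\sup_{A}\left|\int_A\int_A U(x,y)\right|$, the supremum over measurable $A\subset I$; convergence of $\Gamma'_{k_n}$ to $W$ in the cut-norm means $\|\Gamma'_{k_n}-W\|_\square\to0$. *)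

theory Defs
  imports "HOL-Analysis.Analysis"
begin

(* Functions on the unit interval (square) are total functions on the reals (curried); all notions
   below depend only on their values on the unit interval (square). *)

abbreviation unit_ivl :: "real set" where
  "unit_ivl \<equiv> {0..1}"

definition graphon :: "(real \<Rightarrow> real \<Rightarrow> real) \<Rightarrow> bool" where
  "graphon W \<longleftrightarrow>
     (\<lambda>(x, y). W x y) \<in> borel_measurable (lebesgue_on (unit_ivl \<times> unit_ivl)) \<and>
     (\<forall>x\<in>unit_ivl. \<forall>y\<in>unit_ivl. W x y = W y x) \<and>
     (\<forall>x\<in>unit_ivl. \<forall>y\<in>unit_ivl. W x y \<in> {0..1})"

definition conull :: "real set \<Rightarrow> bool" where
  "conull J \<longleftrightarrow> J \<subseteq> unit_ivl \<and> unit_ivl - J \<in> null_sets lebesgue"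

(* The witnessing conull sets are kept as arguments because the inverse of the almost-bijection,
   inv_into J1 \<gamma>, refers to them. *)
definition almost_bijection :: "(real \<Rightarrow> real) \<Rightarrow> real set \<Rightarrow> real set \<Rightarrow> bool" where
  "almost_bijection \<gamma> J1 J2 \<longleftrightarrow>
     \<gamma> \<in> measurable (lebesgue_on unit_ivl) (lebesgue_on unit_ivl) \<and>
     conull J1 \<and> conull J2 \<and> bij_betw \<gamma> J1 J2"

definition measure_preserving :: "(real \<Rightarrow> real) \<Rightarrow> bool" where
  "measure_preserving \<gamma> \<longleftrightarrow>
     (\<forall>A\<in>sets (lebesgue_on unit_ivl). emeasure lebesgue (\<gamma> -` A \<inter> unit_ivl) = emeasure lebesgue A)"

(* inv_into J1 \<gamma> is unspecified outside J2, but that only concerns a null set of pairs. *)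
definition version_of :: "(real \<Rightarrow> real \<Rightarrow> real) \<Rightarrow> (real \<Rightarrow> real \<Rightarrow> real) \<Rightarrow> bool" where
  "version_of \<Gamma>' \<Gamma> \<longleftrightarrow>
     graphon \<Gamma>' \<and> graphon \<Gamma> \<and>
     (\<exists>\<gamma> J1 J2. almost_bijection \<gamma> J1 J2 \<and> measure_preserving \<gamma> \<and>
        (AE (x, y) in lebesgue_on (unit_ivl \<times> unit_ivl).
           \<Gamma>' x y = \<Gamma> (inv_into J1 \<gamma> x) (inv_into J1 \<gamma> y)))"

(* The supremum is taken in the reals, so this is meaningful only if the set of values is bounded;
   for a difference of two graphons it is bounded by 1. *)
definition cut_norm :: "(real \<Rightarrow> real \<Rightarrow> real) \<Rightarrow> real" where
  "cut_norm U =
     (SUP A\<in>sets (lebesgue_on unit_ivl). \<bar>LINT x:A|lebesgue. (LINT y:A|lebesgue. U x y)\<bar>)"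

end

theory Submission
  imports Defs "HOL-Combinatorics.Permutations" "HOL-Library.Diagonal_Subsequence"
begin

text \<open>
  Replace each graphon by a symmetric matrix that is close to it in \<open>L\<^sup>1\<close>. Refine the index set of the
  matrix greedily by rectangles on which the matrix deviates most from its block average; the squared
  deviation is at most the gain in the \<open>L\<^sup>2\<close> energy of the block averages. Sorting the indices by
  their labels turns the blocks into rectangles of intervals and is realised on the graphon by a
  permutation of intervals of equal length, hence by a version. Level by level, the block averages are
  then described by finitely many numbers in the unit interval, uniformly in the graphon, so along a diagonal
  subsequence the level \<open>i\<close> averages converge in \<open>L\<^sup>1\<close> to a step function \<open>W\<^sub>i\<close>. The energies \<open>E\<^sub>i\<close>
  of the \<open>W\<^sub>i\<close> increase and \<open>\<parallel>W\<^sub>j - W\<^sub>i\<parallel>\<^sup>2 = E\<^sub>j - E\<^sub>i\<close> by the Pythagorean theorem, so the \<open>W\<^sub>i\<close> have a limit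
  \<open>W\<close>. In the limit along the subsequence the cut norm distance of the versions to \<open>W\<close> is at most
  \<open>sqrt (E\<^sub>i\<^sub>+\<^sub>1 - E\<^sub>i) + \<parallel>W\<^sub>i - W\<parallel>\<^sub>1\<close> for every \<open>i\<close>, which tends to \<open>0\<close>.
\<close>

subsection \<open>Block averages and greedy refinement\<close>

text \<open>This is conditional expectation given the label \<open>L\<close>, for the uniform
  distribution on \<open>X\<close>. A label with an empty cell gets the value 0, since division by 0
  yields 0, and so stays in the unit interval.\<close>

definition cell_avg :: "'p set \<Rightarrow> ('p \<Rightarrow> 'l) \<Rightarrow> ('p \<Rightarrow> real) \<Rightarrow> 'l \<Rightarrow> real" where
  "cell_avg X L M y = (\<Sum>p\<in>{p\<in>X. L p = y}. M p) / card {p\<in>X. L p = y}"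

text \<open>On a cell both the average and \<open>h\<close> are constant, so the two sides agree
  cell by cell. Tested against a coarser average this identity gives orthogonality; tested against
  the indicator of a rectangle it gives the energy gain of a greedy step.\<close>

lemma sum_cell_avg_mult:
  fixes h :: "'l \<Rightarrow> real"
  assumes "finite X"
  shows "(\<Sum>p\<in>X. cell_avg X L M (L p) * h (L p)) = (\<Sum>p\<in>X. M p * h (L p))"
proof -
  have "(\<Sum>p\<in>{p\<in>X. L p = y}. cell_avg X L M (L p) * h (L p)) =
        (\<Sum>p\<in>{p\<in>X. L p = y}. M p * h (L p))" if "y \<in> L ` X" for y
  proof -
    have "card {p\<in>X. L p = y} \<noteq> 0"
      using that assms by auto
    then have "real (card {p\<in>X. L p = y}) * (cell_avg X L M y * h y) = (\<Sum>p\<in>{p\<in>X. L p = y}. M p) * h y"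
      by (simp add: cell_avg_def)
    then show ?thesis
      by (simp add: sum_distrib_right)
  qed
  then show ?thesis
    by (simp add: sum.image_gen[OF assms, where g = L])
qed

lemma cell_avg_mem_unit:
  assumes "\<And>p. p \<in> X \<Longrightarrow> M p \<in> {0..1}"
  shows "cell_avg X L M y \<in> {0..1}"
proof -
  have "(\<Sum>p\<in>{p\<in>X. L p = y}. M p) \<le> real (card {p\<in>X. L p = y}) * 1"
    by (intro sum_bounded_above) (use assms in auto)
  moreover have "0 \<le> (\<Sum>p\<in>{p\<in>X. L p = y}. M p)"
    by (intro sum_nonneg) (use assms in auto)
  ultimately show ?thesis
    by (auto simp: cell_avg_def divide_le_eq)
qed

text \<open>Exchanging coordinates maps the cell of \<open>(j, k)\<close> bijectively onto that of
  \<open>(k, j)\<close> and preserves \<open>M\<close>. This is what makes the limit function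
  symmetric in the end.\<close>

lemma cell_avg_swap:
  fixes l :: "'a \<Rightarrow> 'l"
  assumes "\<And>a b. M (a, b) = M (b, a)"
  shows "cell_avg (A \<times> A) (\<lambda>(a, b). (l a, l b)) M (j, k) = cell_avg (A \<times> A) (\<lambda>(a, b). (l a, l b)) M (k, j)"
proof -
  have bij: "bij_betw prod.swap {p\<in>A\<times>A. (\<lambda>(a, b). (l a, l b)) p = (j, k)} {p\<in>A\<times>A. (\<lambda>(a, b). (l a, l b)) p = (k, j)}"
    by (rule bij_betwI[of _ _ _ prod.swap]) auto
  have "M (prod.swap p) = M p" for p
    using assms by (cases p) auto
  with bij_betw_same_card[OF bij] sum.reindex_bij_betw[OF bij, of M] show ?thesis
    unfolding cell_avg_def by simp
qed

text \<open>The label \<open>r (L p)\<close> is coarser than \<open>L p\<close>, so \<open>Q\<close>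
  is constant on the cells of \<open>L\<close>. The inner products of \<open>Q\<close> with
  \<open>Q'\<close> and with itself then both equal its inner product with \<open>M\<close>, hence
  \<open>Q' - Q\<close> is orthogonal to \<open>Q\<close>.\<close>

lemma cell_avg_pythagoras:
  fixes M :: "'p \<Rightarrow> real" and L :: "'p \<Rightarrow> 'l" and r :: "'l \<Rightarrow> 'm"
  assumes "finite X"
  defines "Q' \<equiv> \<lambda>p. cell_avg X L M (L p)"
    and "Q \<equiv> \<lambda>p. cell_avg X (\<lambda>p. r (L p)) M (r (L p))"
  shows "(\<Sum>p\<in>X. (Q' p - Q p)\<^sup>2) = (\<Sum>p\<in>X. (Q' p)\<^sup>2) - (\<Sum>p\<in>X. (Q p)\<^sup>2)"
proof -
  have "(\<Sum>p\<in>X. Q' p * Q p) = (\<Sum>p\<in>X. M p * Q p)"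
    unfolding Q'_def Q_def
    using sum_cell_avg_mult[OF assms(1), of L M "\<lambda>y. cell_avg X (\<lambda>p. r (L p)) M (r y)"] .
  also have "\<dots> = (\<Sum>p\<in>X. Q p * Q p)"
    unfolding Q_def
    using sum_cell_avg_mult[OF assms(1), of "\<lambda>p. r (L p)" M "\<lambda>y. cell_avg X (\<lambda>p. r (L p)) M y"] by simp
  finally have eq: "(\<Sum>p\<in>X. Q' p * Q p) = (\<Sum>p\<in>X. (Q p)\<^sup>2)"
    by (simp add: power2_eq_square)
  have "(\<Sum>p\<in>X. (Q' p - Q p)\<^sup>2) = (\<Sum>p\<in>X. (Q' p)\<^sup>2 + (Q p)\<^sup>2 - 2 * (Q' p * Q p))"
    by (simp add: power2_diff mult.assoc)
  also have "\<dots> = (\<Sum>p\<in>X. (Q' p)\<^sup>2) + (\<Sum>p\<in>X. (Q p)\<^sup>2) - 2 * (\<Sum>p\<in>X. Q' p * Q p)"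
    by (simp only: sum.distrib sum_subtractf sum_distrib_left)
  finally show ?thesis
    unfolding eq by simp
qed

lemma exists_maximal_rectangle:
  fixes D :: "'a \<times> 'b \<Rightarrow> real"
  assumes "finite A" "finite B"
  shows "\<exists>S T. S \<subseteq> A \<and> T \<subseteq> B \<and> (\<forall>S' T'. S' \<subseteq> A \<longrightarrow> T' \<subseteq> B \<longrightarrow> (\<Sum>p\<in>S'\<times>T'. D p)\<^sup>2 \<le> (\<Sum>p\<in>S\<times>T. D p)\<^sup>2)"
proof -
  have fin: "finite (Pow A \<times> Pow B)" and ne: "Pow A \<times> Pow B \<noteq> {}"
    using assms by auto
  obtain R where "is_arg_min (\<lambda>(S, T). - (\<Sum>p\<in>S\<times>T. D p)\<^sup>2) (\<lambda>R. R \<in> Pow A \<times> Pow B) R"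
    using ex_is_arg_min_if_finite[OF fin ne] by blast
  then show ?thesis
    unfolding is_arg_min_linorder by (intro exI[of _ "fst R"] exI[of _ "snd R"]) (auto simp: case_prod_beta)
qed

text \<open>Greedy refinement: each label records, in base 4, membership of the index in the successive
  maximal rectangles, so that the maximal rectangle of one step is measurable in the next one.\<close>

lemma greedy_labels:
  fixes M :: "nat \<times> nat \<Rightarrow> real" and N :: nat
  defines "X \<equiv> {..<N} \<times> {..<N}"
  defines "L \<equiv> \<lambda>l :: nat \<Rightarrow> nat. \<lambda>(a, b). (l a, l b)"
  defines "Q \<equiv> \<lambda>l p. cell_avg X (L l) M (L l p)"
  shows "\<exists>l :: nat \<Rightarrow> nat \<Rightarrow> nat. (\<forall>a. l 0 a = 0) \<and> (\<forall>i a. l (Suc i) a div 4 = l i a) \<and>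
    (\<forall>i S T. S \<subseteq> {..<N} \<longrightarrow> T \<subseteq> {..<N} \<longrightarrow>
       (\<Sum>p\<in>S\<times>T. M p - Q (l i) p)\<^sup>2 \<le> real (card X) * ((\<Sum>p\<in>X. (Q (l (Suc i)) p)\<^sup>2) - (\<Sum>p\<in>X. (Q (l i) p)\<^sup>2)))"
proof -
  have finX: "finite X"
    by (simp add: X_def)
  define P where "P l S T \<longleftrightarrow> S \<subseteq> {..<N} \<and> T \<subseteq> {..<N} \<and> (\<forall>S' T'. S' \<subseteq> {..<N} \<longrightarrow> T' \<subseteq> {..<N} \<longrightarrow>
      (\<Sum>p\<in>S'\<times>T'. M p - Q l p)\<^sup>2 \<le> (\<Sum>p\<in>S\<times>T. M p - Q l p)\<^sup>2)" for l S T
  have "\<forall>l. \<exists>S T. P l S T"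
    unfolding P_def by (intro allI exists_maximal_rectangle) auto
  then obtain S T where P: "\<And>l. P l (S l) (T l)"
    by metis
  from P have ST: "\<And>l. S l \<subseteq> {..<N}" "\<And>l. T l \<subseteq> {..<N}"
    and max: "\<And>l S' T'. S' \<subseteq> {..<N} \<Longrightarrow> T' \<subseteq> {..<N} \<Longrightarrow>
      (\<Sum>p\<in>S'\<times>T'. M p - Q l p)\<^sup>2 \<le> (\<Sum>p\<in>S l\<times>T l. M p - Q l p)\<^sup>2"
    by (auto simp: P_def)
  define nxt where "nxt l a = 4 * l a + (2 * of_bool (a \<in> S l) + of_bool (a \<in> T l))" for l :: "nat \<Rightarrow> nat" and a
  define l where "l = rec_nat (\<lambda>_. 0) (\<lambda>_. nxt)"
  have nxt_div: "nxt k a div 4 = k a" for k a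
    by (auto simp: nxt_def)
  have step: "(\<Sum>p\<in>S'\<times>T'. M p - Q k p)\<^sup>2 \<le> real (card X) * ((\<Sum>p\<in>X. (Q (nxt k) p)\<^sup>2) - (\<Sum>p\<in>X. (Q k p)\<^sup>2))"
    if "S' \<subseteq> {..<N}" "T' \<subseteq> {..<N}" for k S' T'
  proof -
    \<comment> \<open>Division by 4 forgets the newest base 4 digit, so the old labelling is a
      coarsening of the new one.\<close>
    define r where "r = (\<lambda>(a, b). (a div 4, b div 4) :: nat \<times> nat)"
    have Lr: "L k = (\<lambda>p. r (L (nxt k) p))"
      by (auto simp: L_def r_def nxt_div fun_eq_iff)
    \<comment> \<open>The newest digit is 2 for membership in \<open>S k\<close> plus 1 for
      membership in \<open>T k\<close>. Hence \<open>mod 4 \<ge> 2\<close> on the first label and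
      oddness of the second recover the indicator of the rectangle.\<close>
    define h where "h = (\<lambda>(j :: nat, k :: nat). of_bool (j mod 4 \<ge> 2 \<and> odd k) :: real)"
    have h: "h (L (nxt k) p) = indicator (S k \<times> T k) p" for p
      by (cases p) (auto simp: h_def L_def nxt_def indicator_def split: if_splits)
    have sub: "S k \<times> T k \<subseteq> X"
      using ST[of k] by (auto simp: X_def)
    have rect: "(\<Sum>p\<in>X. F p * h (L (nxt k) p)) = (\<Sum>p\<in>S k\<times>T k. F p)" for F
    proof -
      have "(\<Sum>p\<in>X. F p * h (L (nxt k) p)) = (\<Sum>p\<in>X. if p \<in> S k \<times> T k then F p else 0)"
        unfolding h by (intro sum.cong refl) (auto simp: indicator_def)
      also have "\<dots> = (\<Sum>p\<in>X \<inter> (S k \<times> T k). F p)"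
        by (rule sum.inter_restrict[OF finX, symmetric])
      also have "X \<inter> (S k \<times> T k) = S k \<times> T k"
        using sub by blast
      finally show ?thesis .
    qed
    \<comment> \<open>The rectangle is a union of cells of the new labelling, so \<open>M\<close>
      and its new average have the same sum over it.\<close>
    have "(\<Sum>p\<in>S k\<times>T k. M p) = (\<Sum>p\<in>S k\<times>T k. Q (nxt k) p)"
      unfolding rect[symmetric] Q_def by (rule sum_cell_avg_mult[OF finX, symmetric])
    then have "(\<Sum>p\<in>S k\<times>T k. M p - Q k p)\<^sup>2 = (\<Sum>p\<in>S k\<times>T k. Q (nxt k) p - Q k p)\<^sup>2"
      by (simp add: sum_subtractf)
    \<comment> \<open>Cauchy-Schwarz against the constant 1; enlarging the rectangle to
      \<open>X\<close> afterwards turns the right side into the full energy gain.\<close>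
    also have "\<dots> \<le> (\<Sum>p\<in>S k\<times>T k. 1\<^sup>2) * (\<Sum>p\<in>S k\<times>T k. (Q (nxt k) p - Q k p)\<^sup>2)"
      using Cauchy_Schwarz_ineq_sum[of "\<lambda>_. 1" "\<lambda>p. Q (nxt k) p - Q k p" "S k \<times> T k"] by simp
    also have "\<dots> \<le> real (card X) * (\<Sum>p\<in>X. (Q (nxt k) p - Q k p)\<^sup>2)"
      using sub finX by (intro mult_mono sum_mono2) (auto simp: card_mono sum_nonneg)
    also have "(\<Sum>p\<in>X. (Q (nxt k) p - Q k p)\<^sup>2) = (\<Sum>p\<in>X. (Q (nxt k) p)\<^sup>2) - (\<Sum>p\<in>X. (Q k p)\<^sup>2)"
      unfolding Q_def Lr by (rule cell_avg_pythagoras[OF finX])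
    finally show ?thesis
      using max[OF that, of k] by linarith
  qed
  show ?thesis
    by (rule exI[of _ l]) (auto simp: l_def nxt_div step)
qed

text \<open>A linear form on a cube is largest at a vertex: dropping the terms with negative
  coefficient and raising the other weights to 1 can only increase the sum. Applied to
  \<open>h\<close> and to \<open>- h\<close>, this bounds the absolute value.\<close>

lemma sum_unit_weights_le:
  fixes h f :: "'a \<Rightarrow> real"
  assumes "finite F" and bound: "\<And>S. S \<subseteq> F \<Longrightarrow> \<bar>\<Sum>a\<in>S. h a\<bar> \<le> B" and f: "\<And>a. a \<in> F \<Longrightarrow> f a \<in> {0..1}"
  shows "\<bar>\<Sum>a\<in>F. f a * h a\<bar> \<le> B"
proof -
  have "(\<Sum>a\<in>F. f a * k a) \<le> \<bar>\<Sum>a\<in>{a\<in>F. 0 \<le> k a}. k a\<bar>" for k :: "'a \<Rightarrow> real"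
  proof -
    have "(\<Sum>a\<in>F. f a * k a) \<le> (\<Sum>a\<in>F. if 0 \<le> k a then k a else 0)"
      using f by (intro sum_mono) (auto simp: mult_left_le_one_le mult_nonneg_nonpos)
    also have "\<dots> = (\<Sum>a\<in>{a\<in>F. 0 \<le> k a}. k a)"
      using assms(1) by (simp add: sum.inter_filter)
    finally show ?thesis by linarith
  qed
  from this[of h] this[of "\<lambda>a. - h a"] show ?thesis
    using bound[of "{a\<in>F. 0 \<le> h a}"] bound[of "{a\<in>F. 0 \<le> - h a}"]
    by (auto simp: sum_negf)
qed

text \<open>The linear bound is applied to one variable at a time. Fractional weights are wanted
  because a measurable set may fill a grid cell only partly.\<close>

lemma bilinear_unit_weights_le:
  fixes D :: "'a \<times> 'b \<Rightarrow> real"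
  assumes fin: "finite F" "finite G"
    and bound: "\<And>S T. S \<subseteq> F \<Longrightarrow> T \<subseteq> G \<Longrightarrow> \<bar>\<Sum>p\<in>S\<times>T. D p\<bar> \<le> B"
    and f: "\<And>a. a \<in> F \<Longrightarrow> f a \<in> {0..1}" and g: "\<And>b. b \<in> G \<Longrightarrow> g b \<in> {0..1}"
  shows "\<bar>\<Sum>a\<in>F. \<Sum>b\<in>G. f a * g b * D (a, b)\<bar> \<le> B"
proof -
  have "\<bar>\<Sum>b\<in>G. g b * (\<Sum>a\<in>S. D (a, b))\<bar> \<le> B" if "S \<subseteq> F" for S
  proof (rule sum_unit_weights_le[OF fin(2) _ g])
    show "\<bar>\<Sum>b\<in>T. \<Sum>a\<in>S. D (a, b)\<bar> \<le> B" if "T \<subseteq> G" for T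
      using bound[OF \<open>S \<subseteq> F\<close> that] by (subst sum.swap) (simp add: sum.cartesian_product)
  qed
  moreover have "(\<Sum>b\<in>G. g b * (\<Sum>a\<in>S. D (a, b))) = (\<Sum>a\<in>S. \<Sum>b\<in>G. g b * D (a, b))" for S
    by (subst sum.swap) (simp add: sum_distrib_left)
  ultimately have "\<bar>\<Sum>a\<in>F. f a * (\<Sum>b\<in>G. g b * D (a, b))\<bar> \<le> B"
    by (intro sum_unit_weights_le[OF fin(1) _ f]) auto
  then show ?thesis
    by (simp add: sum_distrib_left mult.assoc)
qed

subsection \<open>Iterated Lebesgue integrals\<close>

text \<open>Lebesgue measure on the product is the completion of the product of the Borel measures,
  so the exceptional set is first enclosed in a Borel null set; the cylinder over that set is null
  by Fubini.\<close>

lemma AE_lebesgue_fst: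
  fixes P :: "'a::euclidean_space \<Rightarrow> bool"
  assumes "AE x in lebesgue. P x"
  shows "AE p in (lebesgue :: ('a \<times> 'b::euclidean_space) measure). P (fst p)"
proof -
  have "AE x in lborel. P x"
    using assms by (simp add: AE_completion_iff)
  then obtain N where "{x \<in> space lborel. \<not> P x} \<subseteq> N" "emeasure lborel N = 0" "N \<in> sets lborel"
    by (rule AE_E)
  then have N: "N \<in> null_sets lborel" "{x. \<not> P x} \<subseteq> N"
    by auto
  have [measurable]: "N \<in> sets borel"
    using N(1) by auto
  have ae: "AE x in (lborel :: 'a measure). AE y in (lborel :: 'b measure). fst (x, y) \<notin> N"
    using AE_not_in[OF N(1)] by eventually_elim simp
  have "AE p in (lborel :: 'a measure) \<Otimes>\<^sub>M (lborel :: 'b measure). fst p \<notin> N"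
    by (rule lborel_pair.AE_pair_measure[OF _ ae]) measurable
  then have "AE p in (lborel :: ('a \<times> 'b) measure). P (fst p)"
    unfolding lborel_prod using N(2) by (auto elim!: eventually_mono)
  then show ?thesis
    by (simp add: AE_completion)
qed

lemma AE_lebesgue_snd:
  fixes P :: "'b::euclidean_space \<Rightarrow> bool"
  assumes "AE x in lebesgue. P x"
  shows "AE p in (lebesgue :: ('a::euclidean_space \<times> 'b) measure). P (snd p)"
proof -
  have "AE x in lborel. P x"
    using assms by (simp add: AE_completion_iff)
  then obtain N where "{x \<in> space lborel. \<not> P x} \<subseteq> N" "emeasure lborel N = 0" "N \<in> sets lborel"
    by (rule AE_E)
  then have N: "N \<in> null_sets lborel" "{x. \<not> P x} \<subseteq> N"
    by auto
  have [measurable]: "N \<in> sets borel"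
    using N(1) by auto
  have ae: "AE x in (lborel :: 'a measure). AE y in (lborel :: 'b measure). snd (x, y) \<notin> N"
    using AE_not_in[OF N(1)] by simp
  have "AE p in (lborel :: 'a measure) \<Otimes>\<^sub>M (lborel :: 'b measure). snd p \<notin> N"
    by (rule lborel_pair.AE_pair_measure[OF _ ae]) measurable
  then have "AE p in (lborel :: ('a \<times> 'b) measure). P (snd p)"
    unfolding lborel_prod using N(2) by (auto elim!: eventually_mono)
  then show ?thesis
    by (simp add: AE_completion)
qed

lemma lebesgue_measurable_fst:
  fixes f :: "'a::euclidean_space \<Rightarrow> real"
  assumes "f \<in> borel_measurable lebesgue"
  shows "(\<lambda>p. f (fst p)) \<in> borel_measurable (lebesgue :: ('a \<times> 'b::euclidean_space) measure)"
proof -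
  obtain g where g: "g \<in> borel_measurable lborel" "AE x in lborel. f x = g x"
    using completion_ex_borel_measurable_real[OF assms] by auto
  have "AE p in (lebesgue :: ('a \<times> 'b) measure). g (fst p) = f (fst p)"
    using g(2) by (intro AE_lebesgue_fst AE_completion) (auto elim: eventually_mono)
  moreover have "(\<lambda>p. g (fst p)) \<in> borel_measurable (lebesgue :: ('a \<times> 'b) measure)"
    using g(1) by (intro measurable_completion) (simp add: borel_prod[symmetric])
  ultimately show ?thesis
    by (rule borel_measurable_AE[rotated])
qed

lemma lebesgue_measurable_snd:
  fixes f :: "'b::euclidean_space \<Rightarrow> real"
  assumes "f \<in> borel_measurable lebesgue"
  shows "(\<lambda>p. f (snd p)) \<in> borel_measurable (lebesgue :: ('a::euclidean_space \<times> 'b) measure)"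
proof -
  obtain g where g: "g \<in> borel_measurable lborel" "AE x in lborel. f x = g x"
    using completion_ex_borel_measurable_real[OF assms] by auto
  have "AE p in (lebesgue :: ('a \<times> 'b) measure). g (snd p) = f (snd p)"
    using g(2) by (intro AE_lebesgue_snd AE_completion) (auto elim: eventually_mono)
  moreover have "(\<lambda>p. g (snd p)) \<in> borel_measurable (lebesgue :: ('a \<times> 'b) measure)"
    using g(1) by (intro measurable_completion) (simp add: borel_prod[symmetric])
  ultimately show ?thesis
    by (rule borel_measurable_AE[rotated])
qed

lemma lebesgue_sets_Times:
  fixes A :: "'a::euclidean_space set" and B :: "'b::euclidean_space set"
  assumes "A \<in> sets lebesgue" "B \<in> sets lebesgue"
  shows "A \<times> B \<in> sets lebesgue"
proof -
  have "(\<lambda>p. indicator A (fst p) * indicator B (snd p) :: real) \<in> borel_measurable (lebesgue :: ('a \<times> 'b) measure)"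
    using assms by (intro borel_measurable_times lebesgue_measurable_fst lebesgue_measurable_snd) auto
  moreover have "(\<lambda>p. indicator A (fst p) * indicator B (snd p) :: real) = indicator (A \<times> B)"
    by (auto simp: indicator_def fun_eq_iff)
  ultimately show ?thesis
    by (simp add: borel_measurable_indicator_iff)
qed

text \<open>By completeness, functions that agree almost everywhere are both measurable or both
  nonmeasurable. In the second case both integrals have the default value 0.\<close>

lemma integral_lebesgue_cong_AE:
  fixes f g :: "'a::euclidean_space \<Rightarrow> real"
  assumes "AE x in lebesgue. f x = g x"
  shows "integral\<^sup>L lebesgue f = integral\<^sup>L lebesgue g"
proof (cases "f \<in> borel_measurable lebesgue")
  case True
  then have "g \<in> borel_measurable lebesgue"
    using assms by (rule borel_measurable_AE)
  then show ?thesis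
    using True assms by (intro integral_cong_AE) auto
next
  case False
  moreover have "AE x in lebesgue. g x = f x"
    using assms by eventually_elim simp
  ultimately have "g \<notin> borel_measurable lebesgue"
    using borel_measurable_AE by blast
  then show ?thesis
    using False not_integrable_integral_eq borel_measurable_integrable by metis
qed

text \<open>Fubini for the completed measure. \<open>F\<close> is replaced by a Borel function
  \<open>G\<close> equal to it almost everywhere; for almost every \<open>x\<close> their sections
  agree almost everywhere, so inner and outer integrals are unchanged.\<close>

lemma lebesgue_iterated_integral:
  fixes F :: "'a::euclidean_space \<times> 'b::euclidean_space \<Rightarrow> real"
  assumes F: "integrable lebesgue F"
  shows "(LINT x|lebesgue. LINT y|lebesgue. F (x, y)) = integral\<^sup>L lebesgue F"
proof -
  obtain G where G: "G \<in> borel_measurable lborel" "AE p in lborel. F p = G p"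
    using completion_ex_borel_measurable_real F borel_measurable_integrable by blast
  have ae: "AE p in lebesgue. F p = G p"
    using G(2) by (rule AE_completion)
  have "integrable lebesgue G"
    using F G ae measurable_completion[OF G(1)] borel_measurable_integrable[OF F]
    by (subst integrable_cong_AE[of _ _ F]) (auto elim: eventually_mono)
  then have intG: "integrable (lborel \<Otimes>\<^sub>M lborel) G"
    using G(1) by (simp add: integrable_completion lborel_prod)
  have "AE p in (lborel :: 'a measure) \<Otimes>\<^sub>M (lborel :: 'b measure). F p = G p"
    unfolding lborel_prod by (rule G(2))
  from lborel_pair.AE_pair[OF this] have "AE x in lborel. AE y in lborel. F (x, y) = G (x, y)" .
  then have "AE x in lebesgue. AE y in lebesgue. F (x, y) = G (x, y)"
    by (simp add: AE_completion_iff)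
  then have "AE x in lebesgue. (LINT y|lebesgue. F (x, y)) = (LINT y|lebesgue. G (x, y))"
    by eventually_elim (rule integral_lebesgue_cong_AE)
  then have "(LINT x|lebesgue. LINT y|lebesgue. F (x, y)) = (LINT x|lebesgue. LINT y|lebesgue. G (x, y))"
    by (rule integral_lebesgue_cong_AE)
  also have "(\<lambda>x. LINT y|lebesgue. G (x, y)) = (\<lambda>x. LINT y|lborel. G (x, y))"
    using G(1) by (intro ext integral_completion) (simp add: borel_prod[symmetric])
  also have "(LINT x|lebesgue. LINT y|lborel. G (x, y)) = (LINT x|lborel. LINT y|lborel. G (x, y))"
    by (rule integral_completion[OF borel_measurable_integrable[OF lborel_pair.integrable_fst'[OF intG]]])
  also have "\<dots> = integral\<^sup>L lborel G"
    using lborel_pair.integral_fst'[OF intG] by (simp add: lborel_prod)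
  also have "\<dots> = integral\<^sup>L lebesgue G"
    using G(1) by (simp add: integral_completion)
  also have "\<dots> = integral\<^sup>L lebesgue F"
    using ae by (intro integral_lebesgue_cong_AE) (auto elim: eventually_mono)
  finally show ?thesis .
qed

section \<open>The unit square as a probability space, and the cut norm\<close>

lemma unit_square_lebesgue [simp]: "unit_ivl \<times> unit_ivl \<in> sets lebesgue"
  by (intro lebesgue_sets_Times) auto

abbreviation unit_square_measure :: "(real \<times> real) measure" where
  "unit_square_measure \<equiv> lebesgue_on (unit_ivl \<times> unit_ivl)"

lemma emeasure_unit_square: "emeasure unit_square_measure (unit_ivl \<times> unit_ivl) = 1"
proof -
  have "emeasure lebesgue (cbox (0 :: real \<times> real) (1, 1)) = 1"
    by (simp add: emeasure_lborel_cbox_eq Basis_prod_def prod.union_disjoint inj_on_def prod.reindex)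
  moreover have "cbox (0 :: real \<times> real) (1, 1) = unit_ivl \<times> unit_ivl"
    by (simp add: cbox_Pair_eq zero_prod_def)
  ultimately show ?thesis
    by (simp add: emeasure_restrict_space)
qed

interpretation unit_square: finite_measure unit_square_measure
  by (rule finite_measureI) (simp add: emeasure_unit_square space_restrict_space)

lemma integrable_unit_square_bounded:
  fixes f :: "real \<times> real \<Rightarrow> real"
  assumes "f \<in> borel_measurable unit_square_measure" "\<And>p. p \<in> unit_ivl \<times> unit_ivl \<Longrightarrow> \<bar>f p\<bar> \<le> B"
  shows "integrable unit_square_measure f"
  using assms by (intro unit_square.integrable_const_bound[of _ B]) (auto intro!: AE_I2)

lemma indicator_rectangle_measurable:
  assumes "A \<in> sets (lebesgue_on unit_ivl)"
  shows "(\<lambda>p. indicator A (fst p) * indicator A (snd p) :: real) \<in> borel_measurable unit_square_measure"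
  using assms
  by (intro measurable_restrict_space1 borel_measurable_times lebesgue_measurable_fst lebesgue_measurable_snd)
    (auto simp: sets_restrict_space_iff)

lemma iterated_integral_unit_square:
  fixes F :: "real \<times> real \<Rightarrow> real"
  assumes F: "F \<in> borel_measurable unit_square_measure" "\<And>p. p \<in> unit_ivl \<times> unit_ivl \<Longrightarrow> \<bar>F p\<bar> \<le> B"
    and A: "A \<in> sets (lebesgue_on unit_ivl)"
  shows "(LINT x:A|lebesgue. LINT y:A|lebesgue. F (x, y)) =
    (LINT p|unit_square_measure. indicator A (fst p) * indicator A (snd p) * F p)"
proof -
  have sub: "A \<subseteq> unit_ivl" and "A \<in> sets lebesgue"
    using A by (auto simp: sets_restrict_space_iff)
  \<comment> \<open>The extension by 0 to the plane, to which Fubini applies. Since \<open>A\<close>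
    lies in the unit interval, the indicator of the square is absorbed by the two indicators of
    \<open>A\<close>.\<close>
  define G where "G p = indicator (unit_ivl \<times> unit_ivl) p *\<^sub>R (indicator A (fst p) * indicator A (snd p) * F p)" for p
  have "integrable unit_square_measure (\<lambda>p. indicator A (fst p) * indicator A (snd p) * F p)"
    using F(2) indicator_rectangle_measurable[OF A] F(1)
    by (intro integrable_unit_square_bounded[of _ B] borel_measurable_times[of "\<lambda>p. indicator A (fst p) * indicator A (snd p)"])
      (auto simp: indicator_def intro: order_trans[OF abs_ge_zero])
  then have "integrable lebesgue G"
    unfolding G_def by (subst (asm) integrable_restrict_space) auto
  from lebesgue_iterated_integral[OF this]
  have "(LINT x|lebesgue. LINT y|lebesgue. G (x, y)) = integral\<^sup>L lebesgue G" .
  also have "\<dots> = (LINT p|unit_square_measure. indicator A (fst p) * indicator A (snd p) * F p)"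
    unfolding G_def by (rule integral_restrict_space[symmetric]) auto
  finally have "(LINT x|lebesgue. LINT y|lebesgue. G (x, y)) =
    (LINT p|unit_square_measure. indicator A (fst p) * indicator A (snd p) * F p)" .
  moreover have "(LINT y|lebesgue. G (x, y)) = indicator A x *\<^sub>R (LINT y|lebesgue. indicator A y *\<^sub>R F (x, y))" for x
  proof -
    have "G (x, y) = indicator A x * (indicator A y *\<^sub>R F (x, y))" for y
      using sub by (auto simp: G_def indicator_def)
    then show ?thesis
      by simp
  qed
  ultimately show ?thesis
    by (simp add: set_lebesgue_integral_def)
qed

lemma rectangle_integral_le:
  fixes F :: "real \<times> real \<Rightarrow> real"
  assumes F: "integrable unit_square_measure F" and A: "A \<in> sets (lebesgue_on unit_ivl)"
  shows "\<bar>LINT p|unit_square_measure. indicator A (fst p) * indicator A (snd p) * F p\<bar>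
    \<le> (LINT p|unit_square_measure. \<bar>F p\<bar>)"
proof -
  have "integrable unit_square_measure (\<lambda>p. indicator A (fst p) * indicator A (snd p) * F p)"
    using F indicator_rectangle_measurable[OF A]
    by (intro Bochner_Integration.integrable_bound[OF F]) (auto simp: indicator_def intro!: AE_I2)
  then show ?thesis
    using F by (intro order_trans[OF integral_abs_bound] integral_mono) (auto simp: indicator_def)
qed

text \<open>The uniform bound also supplies the boundedness from above without which the real
  supremum carries no information. The empty set shows that the supremum is nonnegative.\<close>

lemma abs_cut_norm_le:
  assumes "\<And>A. A \<in> sets (lebesgue_on unit_ivl) \<Longrightarrow> \<bar>LINT x:A|lebesgue. LINT y:A|lebesgue. U x y\<bar> \<le> e"
  shows "\<bar>cut_norm U\<bar> \<le> e"
proof -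
  have "cut_norm U \<le> e"
    unfolding cut_norm_def using assms by (intro cSUP_least) auto
  moreover have "0 \<le> cut_norm U"
    unfolding cut_norm_def using assms
    by (intro cSUP_upper2[of _ _ "{}"] bdd_aboveI2[of _ _ e]) auto
  ultimately show ?thesis by simp
qed

subsection \<open>Permuting intervals of equal length\<close>

lemma emeasure_lebesgue_translation:
  fixes A :: "'a::euclidean_space set"
  shows "emeasure lebesgue ((+) c ` A) = emeasure lebesgue A"
  using emeasure_lebesgue_affine[of 1 c A] by (simp add: add.commute cong: image_cong_simp)

text \<open>Both the pieces and their translates tile \<open>S\<close>. The preimage of
  \<open>A\<close> is the disjoint union of the parts of \<open>A\<close> in the translated tiles,
  each moved back, so its measure adds up to that of \<open>A\<close>. The general space lets the
  same argument serve the interval and the square.\<close>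

lemma piecewise_translation_measure_preserving:
  fixes T :: "'a::euclidean_space \<Rightarrow> 'a"
  assumes "finite F" and B: "\<And>i. i \<in> F \<Longrightarrow> B i \<in> sets lebesgue"
    and disjB: "disjoint_family_on B F" and S_B: "S = (\<Union>i\<in>F. B i)"
    and T: "\<And>i x. i \<in> F \<Longrightarrow> x \<in> B i \<Longrightarrow> T x = t i + x"
    and disjC: "disjoint_family_on (\<lambda>i. (+) (t i) ` B i) F" and S_C: "S = (\<Union>i\<in>F. (+) (t i) ` B i)"
  shows "T \<in> measurable (lebesgue_on S) (lebesgue_on S)"
    and "\<And>A. A \<in> sets (lebesgue_on S) \<Longrightarrow> emeasure lebesgue (T -` A \<inter> S) = emeasure lebesgue A"
proof -
  have S: "S \<in> sets lebesgue"
    using assms by auto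
  define P where "P A i = (+) (- t i) ` (A \<inter> (+) (t i) ` B i)" for A i
  have P_eq: "P A i = {x \<in> B i. t i + x \<in> A}" for A i
    by (force simp: P_def image_iff)
  have vimage: "T -` A \<inter> S = (\<Union>i\<in>F. P A i)" for A
    unfolding S_B P_eq using T by auto
  have C: "A \<inter> (+) (t i) ` B i \<in> sets lebesgue" if "A \<in> sets (lebesgue_on S)" "i \<in> F" for A i
    using that S B[OF that(2)] by (intro sets.Int lebesgue_sets_translation) (auto simp: sets_restrict_space_iff)
  have P: "P A i \<in> sets lebesgue" if "A \<in> sets (lebesgue_on S)" "i \<in> F" for A i
    using C[OF that] unfolding P_def by (rule lebesgue_sets_translation)
  show "T \<in> measurable (lebesgue_on S) (lebesgue_on S)"
  proof (rule measurableI)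
    show "T x \<in> space (lebesgue_on S)" if "x \<in> space (lebesgue_on S)" for x
    proof -
      have "x \<in> (\<Union>i\<in>F. B i)"
        using that unfolding S_B[symmetric] by (simp add: space_restrict_space)
      then obtain i where "i \<in> F" "x \<in> B i"
        by blast
      then show ?thesis
        using T[of i x] unfolding space_restrict_space by (subst S_C) auto
    qed
    show "T -` A \<inter> space (lebesgue_on S) \<in> sets (lebesgue_on S)" if "A \<in> sets (lebesgue_on S)" for A
    proof -
      have "T -` A \<inter> S \<in> sets lebesgue"
        unfolding vimage using P[OF that] \<open>finite F\<close> by auto
      then show ?thesis
        using S by (simp add: space_restrict_space sets_restrict_space_iff)
    qed
  qed
  show "emeasure lebesgue (T -` A \<inter> S) = emeasure lebesgue A" if A: "A \<in> sets (lebesgue_on S)" for A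
  proof -
    have "disjoint_family_on (P A) F"
      using disjB unfolding disjoint_family_on_def P_eq by blast
    then have "emeasure lebesgue (T -` A \<inter> S) = (\<Sum>i\<in>F. emeasure lebesgue (P A i))"
      unfolding vimage using P[OF A] \<open>finite F\<close> by (intro sum_emeasure[symmetric]) auto
    also have "\<dots> = (\<Sum>i\<in>F. emeasure lebesgue (A \<inter> (+) (t i) ` B i))"
      unfolding P_def emeasure_lebesgue_translation ..
    also have "\<dots> = emeasure lebesgue (\<Union>i\<in>F. A \<inter> (+) (t i) ` B i)"
      using disjC C[OF A] \<open>finite F\<close> by (intro sum_emeasure) (auto simp: disjoint_family_on_def)
    also have "(\<Union>i\<in>F. A \<inter> (+) (t i) ` B i) = A"
      using A S by (auto simp: S_C[symmetric] sets_restrict_space_iff simp flip: Int_UN_distrib)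
    finally show ?thesis .
  qed
qed

section \<open>The uniform grid and the permutations of its cells\<close>

definition grid :: "nat \<Rightarrow> real \<Rightarrow> nat" where
  "grid N x = nat \<lfloor>real N * x\<rfloor>"

text \<open>The point \<open>1\<close> forms the extra null cell with index \<open>N\<close>, which permutations of \<open>{..<N}\<close> fix.\<close>

definition grid_cell :: "nat \<Rightarrow> nat \<Rightarrow> real set" where
  "grid_cell N a = {x \<in> unit_ivl. grid N x = a}"

text \<open>The interval exchange that carries the cell with index \<open>a\<close> by translation
  onto the cell with index \<open>\<sigma> a\<close>.\<close>

definition shuffle :: "nat \<Rightarrow> (nat \<Rightarrow> nat) \<Rightarrow> real \<Rightarrow> real" where
  "shuffle N \<sigma> x = (real (\<sigma> (grid N x)) - real (grid N x)) / N + x"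

lemma grid_eq_iff: "0 \<le> x \<Longrightarrow> grid N x = a \<longleftrightarrow> real a \<le> real N * x \<and> real N * x < real a + 1"
  unfolding grid_def by (auto simp: nat_eq_iff floor_eq_iff)

lemma grid_le:
  assumes "x \<in> unit_ivl"
  shows "grid N x \<le> N"
proof -
  have "real N * x \<le> real N"
    using assms by (intro mult_left_le) auto
  then show ?thesis
    unfolding grid_def by linarith
qed

lemma grid_less: "0 < N \<Longrightarrow> 0 \<le> x \<Longrightarrow> x < 1 \<Longrightarrow> grid N x < N"
  unfolding grid_def by (auto simp: nat_less_iff floor_less_iff)

lemma grid_cell_eq:
  assumes "a < N"
  shows "grid_cell N a = {real a / N ..< (real a + 1) / N}"
proof -
  have "(real a + 1) / N \<le> 1"
    using assms by (simp add: divide_le_eq)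
  then have lt1: "x < 1" if "x < (real a + 1) / N" for x
    using that by (rule less_le_trans[rotated])
  have ge0: "0 \<le> x" if "real a / N \<le> x" for x
    using that by (rule order_trans[rotated]) simp
  have scale: "real a \<le> real N * x \<longleftrightarrow> real a / N \<le> x" "real N * x < real a + 1 \<longleftrightarrow> x < (real a + 1) / N" for x
    using assms by (simp_all add: divide_le_eq less_divide_eq mult.commute)
  have "x \<in> grid_cell N a \<longleftrightarrow> x \<in> {real a / N ..< (real a + 1) / N}" for x
    unfolding grid_cell_def atLeastAtMost_iff atLeastLessThan_iff mem_Collect_eq
    using grid_eq_iff[of x N a] scale[of x] lt1[of x] ge0[of x] less_imp_le[of x 1] by blast
  then show ?thesis
    by blast
qed

lemma grid_cell_lebesgue [simp]: "grid_cell N a \<in> sets lebesgue"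
proof -
  have "grid_cell N a = unit_ivl \<inter> {x. real a \<le> real N * x} \<inter> {x. real N * x < real a + 1}"
  proof (rule set_eqI)
    show "x \<in> grid_cell N a \<longleftrightarrow> x \<in> unit_ivl \<inter> {x. real a \<le> real N * x} \<inter> {x. real N * x < real a + 1}" for x
      using grid_eq_iff[of x N a] by (auto simp: grid_cell_def)
  qed
  also have "\<dots> \<in> sets borel"
    by measurable
  finally show ?thesis
    by (intro sets_completionI_sets) simp
qed

lemma measure_grid_cell:
  assumes "a < N"
  shows "measure lebesgue (grid_cell N a) = 1 / N"
  using assms by (simp add: grid_cell_eq[OF assms] divide_right_mono flip: diff_divide_distrib)

lemma shuffle_image_cell:
  assumes "0 < N" "\<sigma> permutes {..<N}" "a \<le> N"
  shows "(+) ((real (\<sigma> a) - real a) / N) ` grid_cell N a = grid_cell N (\<sigma> a)"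
proof (cases "a = N")
  case True
  then have "\<sigma> a = a"
    using assms(2) by (auto intro: permutes_not_in)
  then show ?thesis by simp
next
  case False
  then have "a < N" "\<sigma> a < N"
    using assms permutes_in_image[OF assms(2), of a] by auto
  then show ?thesis
    by (simp add: grid_cell_eq diff_divide_distrib add_divide_distrib add.commute)
qed

lemma grid_shuffle:
  assumes "0 < N" "\<sigma> permutes {..<N}" "x \<in> unit_ivl"
  shows "shuffle N \<sigma> x \<in> unit_ivl" "grid N (shuffle N \<sigma> x) = \<sigma> (grid N x)"
proof -
  have "x \<in> grid_cell N (grid N x)"
    using assms by (simp add: grid_cell_def)
  then have "shuffle N \<sigma> x \<in> grid_cell N (\<sigma> (grid N x))"
    unfolding shuffle_image_cell[OF assms(1,2) grid_le[OF assms(3)], symmetric]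
    by (simp add: shuffle_def)
  then show "shuffle N \<sigma> x \<in> unit_ivl" "grid N (shuffle N \<sigma> x) = \<sigma> (grid N x)"
    by (simp_all add: grid_cell_def)
qed

lemma shuffle_inv:
  assumes "0 < N" "\<sigma> permutes {..<N}" "x \<in> unit_ivl"
  shows "shuffle N (inv \<sigma>) (shuffle N \<sigma> x) = x"
  unfolding shuffle_def[of N "inv \<sigma>"] grid_shuffle(2)[OF assms]
  by (simp add: permutes_inverses[OF assms(2)] shuffle_def diff_divide_distrib)

lemma Union_grid_cells: "(\<Union>a\<in>{..N}. grid_cell N a) = unit_ivl"
  using grid_le by (auto simp: grid_cell_def)

lemma
  assumes "0 < N" "\<sigma> permutes {..<N}"
  shows shuffle_measurable: "shuffle N \<sigma> \<in> measurable (lebesgue_on unit_ivl) (lebesgue_on unit_ivl)"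
    and shuffle_measure_preserving: "measure_preserving (shuffle N \<sigma>)"
proof -
  \<comment> \<open>The tiling includes the null cell at the point 1, whose index \<open>N\<close>
    is fixed.\<close>
  have perm: "\<sigma> permutes {..N}"
    using assms(2) by (rule permutes_subset) auto
  define t where "t a = (real (\<sigma> a) - real a) / N" for a
  have image: "(+) (t a) ` grid_cell N a = grid_cell N (\<sigma> a)" if "a \<in> {..N}" for a
    using shuffle_image_cell[OF assms] that by (simp add: t_def)
  have "(\<Union>a\<in>{..N}. (+) (t a) ` grid_cell N a) = (\<Union>a\<in>{..N}. grid_cell N (\<sigma> a))"
    by (rule SUP_cong[OF refl image])
  also have "\<dots> = (\<Union>a\<in>\<sigma> ` {..N}. grid_cell N a)"
    by simp
  also have "\<dots> = unit_ivl"
    by (simp only: permutes_image[OF perm] Union_grid_cells)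
  finally have un: "unit_ivl = (\<Union>a\<in>{..N}. (+) (t a) ` grid_cell N a)" ..
  have disj: "disjoint_family_on (\<lambda>a. (+) (t a) ` grid_cell N a) {..N}"
    unfolding disjoint_family_on_def
  proof (intro ballI impI)
    fix a b assume "a \<in> {..N}" "b \<in> {..N}" "a \<noteq> b"
    moreover then have "\<sigma> a \<noteq> \<sigma> b"
      using permutes_inj[OF perm] by (blast dest: injD)
    ultimately show "(+) (t a) ` grid_cell N a \<inter> (+) (t b) ` grid_cell N b = {}"
      by (simp only: image) (auto simp: grid_cell_def)
  qed
  have disj': "disjoint_family_on (grid_cell N) {..N}"
    by (auto simp: disjoint_family_on_def grid_cell_def)
  have T: "shuffle N \<sigma> x = t a + x" if "a \<in> {..N}" "x \<in> grid_cell N a" for a x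
    using that by (simp add: shuffle_def t_def grid_cell_def)
  note * = piecewise_translation_measure_preserving[OF finite_atMost grid_cell_lebesgue disj' Union_grid_cells[symmetric] T disj un]
  show "shuffle N \<sigma> \<in> measurable (lebesgue_on unit_ivl) (lebesgue_on unit_ivl)"
    by (rule *(1))
  show "measure_preserving (shuffle N \<sigma>)"
    using *(2) by (simp add: measure_preserving_def)
qed

text \<open>The square is tiled by products of cells, so the tiling argument applies to it directly,
  without a detour through product measures. The \<open>distr\<close> form gives change of
  variables.\<close>

lemma
  assumes N: "0 < N" and \<sigma>: "\<sigma> permutes {..<N}"
  shows shuffle_square_measurable:
      "map_prod (shuffle N \<sigma>) (shuffle N \<sigma>) \<in> measurable unit_square_measure unit_square_measure" (is "?T \<in> _")
    and distr_shuffle_square: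
      "distr unit_square_measure unit_square_measure (map_prod (shuffle N \<sigma>) (shuffle N \<sigma>)) = unit_square_measure"
proof -
  define B where "B = (\<lambda>(a, b). grid_cell N a \<times> grid_cell N b)"
  define t where "t = (\<lambda>(a, b). ((real (\<sigma> a) - real a) / N, (real (\<sigma> b) - real b) / N))"
  let ?F = "{..N} \<times> {..N}"
  have perm: "\<sigma> permutes {..N}"
    using \<sigma> by (rule permutes_subset) auto
  have image: "(+) (t i) ` B i = B (map_prod \<sigma> \<sigma> i)" if i_mem: "i \<in> ?F" for i
  proof -
    obtain a b where i: "i = (a, b)" "a \<le> N" "b \<le> N"
      using i_mem by auto
    have "(+) (t i) ` B i = ((+) ((real (\<sigma> a) - real a) / N) ` grid_cell N a) \<times> ((+) ((real (\<sigma> b) - real b) / N) ` grid_cell N b)"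
      by (force simp: i t_def B_def image_iff)
    then show ?thesis
      by (simp add: i B_def shuffle_image_cell[OF N \<sigma>])
  qed
  have T: "?T x = t i + x" if "x \<in> B i" for i x
    using that by (auto simp: B_def t_def shuffle_def grid_cell_def)
  have disj: "disjoint_family_on B ?F"
    by (auto simp: disjoint_family_on_def B_def grid_cell_def)
  have "inj (map_prod \<sigma> \<sigma>)"
    using permutes_inj[OF perm] by (intro prod.inj_map)
  then have "disjoint_family_on (\<lambda>i. B (map_prod \<sigma> \<sigma> i)) ?F"
    by (auto simp: disjoint_family_on_def B_def grid_cell_def dest: injD[OF permutes_inj[OF perm]])
  then have disj': "disjoint_family_on (\<lambda>i. (+) (t i) ` B i) ?F"
    by (auto simp: disjoint_family_on_def image)
  have un: "unit_ivl \<times> unit_ivl = (\<Union>i\<in>?F. B i)"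
    using Union_grid_cells[of N] by (auto simp: B_def) (auto simp: grid_cell_def grid_le)
  also have "\<dots> = (\<Union>i\<in>map_prod \<sigma> \<sigma> ` ?F. B i)"
    using permutes_image[OF perm] by (simp add: map_prod_surj_on)
  also have "\<dots> = (\<Union>i\<in>?F. (+) (t i) ` B i)"
    using image by simp
  finally have un': "unit_ivl \<times> unit_ivl = (\<Union>i\<in>?F. (+) (t i) ` B i)" .
  have Bm: "B i \<in> sets lebesgue" for i
    by (cases i) (auto simp: B_def intro: lebesgue_sets_Times)
  note pt = piecewise_translation_measure_preserving[of ?F B _ ?T t, OF _ Bm disj un T disj' un']
  show meas: "?T \<in> measurable unit_square_measure unit_square_measure"
    by (rule pt(1)) auto
  show "distr unit_square_measure unit_square_measure ?T = unit_square_measure"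
  proof (rule measure_eqI)
    fix A assume A: "A \<in> sets (distr unit_square_measure unit_square_measure ?T)"
    then have A': "A \<in> sets unit_square_measure" by simp
    have "emeasure (distr unit_square_measure unit_square_measure ?T) A = emeasure lebesgue (?T -` A \<inter> (unit_ivl \<times> unit_ivl))"
      using meas A' by (simp add: emeasure_distr space_restrict_space emeasure_restrict_space)
    also have "\<dots> = emeasure lebesgue A"
      using A' by (intro pt(2)) auto
    also have "\<dots> = emeasure unit_square_measure A"
      using A' by (auto simp: emeasure_restrict_space sets_restrict_space_iff)
    finally show "emeasure (distr unit_square_measure unit_square_measure ?T) A = emeasure unit_square_measure A" .
  qed simp
qed

lemma integral_shuffle_square:
  fixes f :: "real \<times> real \<Rightarrow> real"
  assumes "0 < N" "\<sigma> permutes {..<N}" "f \<in> borel_measurable unit_square_measure"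
  shows "(LINT p|unit_square_measure. f (map_prod (shuffle N \<sigma>) (shuffle N \<sigma>) p)) = integral\<^sup>L unit_square_measure f"
  using integral_distr[OF shuffle_square_measurable[OF assms(1,2)] assms(3)]
  by (simp add: distr_shuffle_square[OF assms(1,2)])

text \<open>A version is composed with the inverse of the almost-bijection. The witness is therefore
  the shuffle by \<open>inv \<sigma>\<close>, whose inverse on the whole unit interval is the
  shuffle by \<open>\<sigma>\<close>.\<close>

lemma version_of_shuffle:
  assumes U: "graphon U" and N: "0 < N" and \<sigma>: "\<sigma> permutes {..<N}"
  shows "version_of (\<lambda>x y. U (shuffle N \<sigma> x) (shuffle N \<sigma> y)) U"
proof -
  let ?\<gamma> = "shuffle N (inv \<sigma>)"
  have inv: "inv \<sigma> permutes {..<N}" "inv (inv \<sigma>) = \<sigma>"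
    using \<sigma> by (simp_all add: permutes_inv permutes_inv_inv)
  have inv1: "?\<gamma> (shuffle N \<sigma> x) = x" and inv2: "shuffle N \<sigma> (?\<gamma> x) = x" if "x \<in> unit_ivl" for x
    using shuffle_inv[OF N \<sigma> that] shuffle_inv[OF N inv(1) that] inv(2) by auto
  have bij: "bij_betw ?\<gamma> unit_ivl unit_ivl"
    by (rule bij_betwI[of _ _ _ "shuffle N \<sigma>"])
      (use grid_shuffle(1)[OF N \<sigma>] grid_shuffle(1)[OF N inv(1)] inv1 inv2 in blast)+
  have "inv_into unit_ivl ?\<gamma> x = shuffle N \<sigma> x" if "x \<in> unit_ivl" for x
    using inv_into_f_eq[OF bij_betw_imp_inj_on[OF bij] grid_shuffle(1)[OF N \<sigma> that] inv1[OF that]] .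
  then have "AE (x, y) in unit_square_measure.
      U (shuffle N \<sigma> x) (shuffle N \<sigma> y) = U (inv_into unit_ivl ?\<gamma> x) (inv_into unit_ivl ?\<gamma> y)"
    by (intro AE_I2) (auto simp: space_restrict_space)
  moreover have "almost_bijection ?\<gamma> unit_ivl unit_ivl"
    using shuffle_measurable[OF N inv(1)] bij by (simp add: almost_bijection_def conull_def)
  moreover have "graphon (\<lambda>x y. U (shuffle N \<sigma> x) (shuffle N \<sigma> y))"
  proof -
    have "(\<lambda>p. (\<lambda>(x, y). U x y) (map_prod (shuffle N \<sigma>) (shuffle N \<sigma>) p)) \<in> borel_measurable unit_square_measure"
      using U by (intro measurable_compose[OF shuffle_square_measurable[OF N \<sigma>]]) (simp add: graphon_def)
    then have "(\<lambda>(x, y). U (shuffle N \<sigma> x) (shuffle N \<sigma> y)) \<in> borel_measurable unit_square_measure"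
      by (simp add: case_prod_beta')
    then show ?thesis
      using U grid_shuffle(1)[OF N \<sigma>] unfolding graphon_def by blast
  qed
  ultimately show ?thesis
    using U shuffle_measure_preserving[OF N inv(1)] unfolding version_of_def by blast
qed

section \<open>Integrals of step functions on the grid\<close>

lemma AE_unit_square_less_one: "AE p in unit_square_measure. fst p \<in> {0..<1} \<and> snd p \<in> {0..<1}"
proof -
  have "{1 :: real} \<in> null_sets lborel"
    by auto
  then have "AE x in lebesgue. x \<noteq> (1 :: real)"
    using AE_completion[OF AE_not_in] by fastforce
  then have "AE p in (lebesgue :: (real \<times> real) measure). fst p \<noteq> 1 \<and> snd p \<noteq> 1"
    by (intro AE_conjI AE_lebesgue_fst AE_lebesgue_snd)
  then have "AE p in lebesgue. p \<in> unit_ivl \<times> unit_ivl \<longrightarrow> fst p \<in> {0..<1} \<and> snd p \<in> {0..<1}"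
    by eventually_elim auto
  then show ?thesis
    by (subst AE_restrict_space_iff) (assumption | simp)+
qed

lemma grid_measurable [measurable]: "(\<lambda>x. grid N x) \<in> measurable borel (count_space UNIV)"
  unfolding grid_def by measurable

lemma step_measurable:
  fixes D :: "nat \<times> nat \<Rightarrow> real"
  assumes u: "u \<in> measurable borel (count_space UNIV)" and v: "v \<in> measurable borel (count_space UNIV)"
  shows "(\<lambda>p. D (u (fst p), v (snd p))) \<in> borel_measurable (unit_square_measure :: (real \<times> real) measure)"
proof -
  have "(\<lambda>p. (u (fst p), v (snd p))) \<in> measurable (borel \<Otimes>\<^sub>M borel) (count_space UNIV \<Otimes>\<^sub>M count_space UNIV)"
    using u v by measurable
  then have "(\<lambda>p. (u (fst p), v (snd p))) \<in> measurable lborel (count_space UNIV)"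
    by (simp add: borel_prod pair_measure_countable)
  then have "(\<lambda>p. D (u (fst p), v (snd p))) \<in> borel_measurable lborel"
    by (rule measurable_compose) simp
  then show ?thesis
    by (intro measurable_restrict_space1 measurable_completion)
qed

lemma integral_unit_square_rectangle:
  assumes B: "B \<in> sets lebesgue" "B \<subseteq> unit_ivl" and C: "C \<in> sets lebesgue" "C \<subseteq> unit_ivl"
  shows "(LINT p|unit_square_measure. indicator B (fst p) * indicator C (snd p)) = measure lebesgue B * measure lebesgue C"
proof -
  have BC: "B \<times> C \<in> sets lebesgue"
    using B C by (intro lebesgue_sets_Times)
  have "emeasure lebesgue (B \<times> C) \<le> emeasure lebesgue (unit_ivl \<times> unit_ivl)"
    using B C by (intro emeasure_mono) auto
  also have "\<dots> = 1"
    using emeasure_unit_square by (simp add: emeasure_restrict_space)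
  finally have "emeasure lebesgue (B \<times> C) < \<infinity>"
    using le_less_trans by fastforce
  then have int: "integrable lebesgue (indicator (B \<times> C) :: _ \<Rightarrow> real)"
    using BC by simp
  have "(LINT p|unit_square_measure. indicator B (fst p) * indicator C (snd p) :: real) =
      (LINT p|lebesgue. indicator (unit_ivl \<times> unit_ivl) p *\<^sub>R (indicator B (fst p) * indicator C (snd p)))"
    by (rule integral_restrict_space) simp
  also have "\<dots> = (LINT p|lebesgue. indicator (B \<times> C) p)"
    using B C by (intro Bochner_Integration.integral_cong) (auto simp: indicator_def)
  also have "\<dots> = (LINT x|lebesgue. LINT y|lebesgue. indicator (B \<times> C) (x, y))"
    using lebesgue_iterated_integral[OF int] by simp
  also have "\<dots> = (LINT x|lebesgue. indicator B x * measure lebesgue C)"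
    using C by (simp add: indicator_times)
  also have "\<dots> = measure lebesgue B * measure lebesgue C"
    using B by simp
  finally show ?thesis .
qed

text \<open>A pair of cells contributes the value of the step function times the measures of the
  parts of \<open>A\<close> in the two cells. The integral thus becomes a bilinear form, which is
  where bounds on rectangles of indices can be applied.\<close>

lemma rectangle_integral_step:
  fixes F D :: "_ \<Rightarrow> real"
  assumes N: "0 < N" and meas: "F \<in> borel_measurable unit_square_measure"
    and F: "\<And>x y. x \<in> {0..<1} \<Longrightarrow> y \<in> {0..<1} \<Longrightarrow> F (x, y) = D (grid N x, grid N y)"
    and A: "A \<in> sets (lebesgue_on unit_ivl)"
  shows "(LINT p|unit_square_measure. indicator A (fst p) * indicator A (snd p) * F p) =
    (\<Sum>a<N. \<Sum>b<N. measure lebesgue (A \<inter> grid_cell N a) * measure lebesgue (A \<inter> grid_cell N b) * D (a, b))"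
proof -
  have A': "A \<in> sets lebesgue" "A \<subseteq> unit_ivl"
    using A by (auto simp: sets_restrict_space_iff)
  define I :: "nat \<Rightarrow> real \<Rightarrow> real" where "I a = indicator (A \<inter> grid_cell N a)" for a
  have Im: "(\<lambda>p. I a (fst p) * I b (snd p)) \<in> borel_measurable unit_square_measure" for a b
    unfolding I_def using A'
    by (intro measurable_restrict_space1 borel_measurable_times lebesgue_measurable_fst lebesgue_measurable_snd
        borel_measurable_indicator sets.Int) auto
  have Ii: "integrable unit_square_measure (\<lambda>p. I a (fst p) * I b (snd p))" for a b
    by (intro integrable_unit_square_bounded[of _ 1] Im) (auto simp: I_def indicator_def)
  have "(\<Sum>a<N. \<Sum>b<N. I a x * I b y * D (a, b)) = indicator A x * indicator A y * D (grid N x, grid N y)"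
    if "x \<in> {0..<1}" "y \<in> {0..<1}" for x y
  proof -
    have *: "I a z = (if a = grid N z then indicator A z else 0)" for a z
      using A' by (auto simp: I_def indicator_def grid_cell_def)
    show ?thesis
      using that grid_less[OF N, of x] grid_less[OF N, of y]
      by (simp add: * if_distrib[of "\<lambda>x. x * _"] if_distrib[of "\<lambda>x. _ * x"] cong: if_cong)
  qed
  note expand = this
  \<comment> \<open>Where a coordinate equals 1 its grid index is \<open>N\<close>, outside the
    range of the sums; these edges are null.\<close>
  have "AE p in unit_square_measure. indicator A (fst p) * indicator A (snd p) * F p =
      (\<Sum>a<N. \<Sum>b<N. I a (fst p) * I b (snd p) * D (a, b))"
    using AE_unit_square_less_one
  proof eventually_elim
    case (elim p)
    then show ?case
      using expand[of "fst p" "snd p"] F[of "fst p" "snd p"] by simp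
  qed
  then have "(LINT p|unit_square_measure. indicator A (fst p) * indicator A (snd p) * F p) =
      (LINT p|unit_square_measure. (\<Sum>a<N. \<Sum>b<N. I a (fst p) * I b (snd p) * D (a, b)))"
    using indicator_rectangle_measurable[OF A] meas Im
    by (intro integral_cong_AE borel_measurable_sum borel_measurable_times[of "\<lambda>p. indicator A (fst p) * indicator A (snd p)"]
        borel_measurable_times[of "\<lambda>p. I _ (fst p) * I _ (snd p)"]) auto
  also have "\<dots> = (\<Sum>a<N. \<Sum>b<N. (LINT p|unit_square_measure. I a (fst p) * I b (snd p)) * D (a, b))"
    using Ii by (simp add: Bochner_Integration.integral_sum Bochner_Integration.integrable_sum)
  also have "\<dots> = (\<Sum>a<N. \<Sum>b<N. measure lebesgue (A \<inter> grid_cell N a) * measure lebesgue (A \<inter> grid_cell N b) * D (a, b))"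
    unfolding I_def using A' by (subst integral_unit_square_rectangle) auto
  finally show ?thesis .
qed

lemma integral_step:
  fixes F D :: "_ \<Rightarrow> real"
  assumes N: "0 < N" and meas: "F \<in> borel_measurable unit_square_measure"
    and F: "\<And>x y. x \<in> {0..<1} \<Longrightarrow> y \<in> {0..<1} \<Longrightarrow> F (x, y) = D (grid N x, grid N y)"
  shows "integral\<^sup>L unit_square_measure F = (\<Sum>p\<in>{..<N}\<times>{..<N}. D p) / (real N)\<^sup>2"
proof -
  have "integral\<^sup>L unit_square_measure F = (LINT p|unit_square_measure. indicator unit_ivl (fst p) * indicator unit_ivl (snd p) * F p)"
    by (intro Bochner_Integration.integral_cong) (auto simp: space_restrict_space)
  also have "\<dots> = (\<Sum>a<N. \<Sum>b<N. (1 / N) * (1 / N) * D (a, b))"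
  proof -
    have "unit_ivl \<inter> grid_cell N a = grid_cell N a" for a
      by (auto simp: grid_cell_def)
    then show ?thesis
      using rectangle_integral_step[OF assms, of unit_ivl]
      by (simp add: measure_grid_cell sets_restrict_space_iff)
  qed
  also have "\<dots> = (\<Sum>p\<in>{..<N}\<times>{..<N}. D p) / (real N)\<^sup>2"
    by (simp add: sum.cartesian_product sum_divide_distrib power2_eq_square divide_simps)
  finally show ?thesis .
qed

subsection \<open>Step function approximation\<close>

text \<open>A measurable function is an almost everywhere limit of continuous ones. Clamping these
  to the unit interval and averaging them with their reflection keeps the limit, dominated
  convergence gives closeness in mean, and uniform continuity allows sampling on a fine
  grid.\<close>

lemma graphon_step_approximation:
  assumes U: "graphon U" and "0 < e"
  shows "\<exists>N M. 0 < N \<and> (\<forall>a b. M (a, b) = M (b, a)) \<and> (\<forall>p. M p \<in> {0..1}) \<and>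
    (LINT p|unit_square_measure. \<bar>(\<lambda>(x, y). U x y) p - M (grid N (fst p), grid N (snd p))\<bar>) \<le> e"
proof -
  let ?I = "unit_ivl \<times> unit_ivl"
  define f where "f = (\<lambda>(x, y). U x y)"
  have fm: "f \<in> borel_measurable unit_square_measure" and f01: "\<And>p. p \<in> ?I \<Longrightarrow> f p \<in> {0..1}"
    and fs: "\<And>p. p \<in> ?I \<Longrightarrow> f (prod.swap p) = f p"
    using U by (auto simp: graphon_def f_def)
  have "f measurable_on ?I"
    using fm by (simp add: measurable_on_iff_borel_measurable)
  then obtain Z g where Z: "negligible Z" and g: "\<And>n. continuous_on UNIV (g n)"
    and lim: "\<And>p. p \<notin> Z \<Longrightarrow> (\<lambda>n. g n p) \<longlonglongrightarrow> (if p \<in> ?I then f p else 0)"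
    unfolding measurable_on_def by blast
  define cl where "cl t = max 0 (min 1 t)" for t :: real
  define h where "h n p = (cl (g n p) + cl (g n (prod.swap p))) / 2" for n p
  have h01: "h n p \<in> {0..1}" and hs: "h n (prod.swap p) = h n p" for n p
    by (auto simp: h_def cl_def)
  have hc: "continuous_on UNIV (h n)" for n
    unfolding h_def cl_def by (intro continuous_intros continuous_on_compose2[OF g]) auto
  have hm: "h n \<in> borel_measurable unit_square_measure" for n
    by (intro measurable_restrict_space1 measurable_completion) (use hc borel_measurable_continuous_onI in auto)
  \<comment> \<open>Convergence is used at \<open>p\<close> and at its reflection, so the reflected
    exceptional set must be null as well.\<close>
  have "linear (prod.swap :: real \<times> real \<Rightarrow> _)"
    by (intro linearI) (auto simp: prod.swap_def)
  then have "negligible (prod.swap ` Z)"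
    using Z by (intro negligible_differentiable_image_negligible linear_imp_differentiable_on) auto
  then have "Z \<union> prod.swap ` Z \<in> null_sets lebesgue"
    using Z by (simp add: negligible_iff_null_sets[symmetric] negligible_Un)
  then have "AE p in lebesgue. p \<notin> Z \<union> prod.swap ` Z"
    by (rule AE_not_in)
  then have ae: "AE p in unit_square_measure. p \<in> ?I \<and> p \<notin> Z \<and> prod.swap p \<notin> Z"
  proof (subst AE_restrict_space_iff)
    show "AE p in lebesgue. p \<in> ?I \<longrightarrow> p \<in> ?I \<and> p \<notin> Z \<and> prod.swap p \<notin> Z"
      using \<open>AE p in lebesgue. p \<notin> Z \<union> prod.swap ` Z\<close>
    proof eventually_elim
      case (elim p)
      then have "prod.swap p \<notin> Z"
        by (metis UnI2 image_eqI swap_swap)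
      with elim show ?case by blast
    qed
  qed simp
  have conv: "AE p in unit_square_measure. (\<lambda>n. \<bar>f p - h n p\<bar>) \<longlonglongrightarrow> 0"
    using ae
  proof eventually_elim
    case (elim p)
    have "prod.swap p \<in> ?I"
      using elim by auto
    then have "(\<lambda>n. g n p) \<longlonglongrightarrow> f p" "(\<lambda>n. g n (prod.swap p)) \<longlonglongrightarrow> f p"
      using lim[of p] lim[of "prod.swap p"] elim fs[of p] by auto
    then have "(\<lambda>n. h n p) \<longlonglongrightarrow> (cl (f p) + cl (f p)) / 2"
      unfolding h_def cl_def by (intro tendsto_intros) auto
    moreover have "cl (f p) = f p"
      using f01[of p] elim by (auto simp: cl_def)
    ultimately have "(\<lambda>n. \<bar>f p - h n p\<bar>) \<longlonglongrightarrow> \<bar>f p - f p\<bar>"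
      by (intro tendsto_intros) auto
    then show ?case by simp
  qed
  have "(\<lambda>n. LINT p|unit_square_measure. \<bar>f p - h n p\<bar>) \<longlonglongrightarrow> (LINT p|unit_square_measure. 0)"
  proof (rule integral_dominated_convergence[where w = "\<lambda>_. 1", OF _ _ _ conv])
    show "AE p in unit_square_measure. norm \<bar>f p - h n p\<bar> \<le> 1" for n
    proof (rule AE_I2)
      fix p assume "p \<in> space unit_square_measure"
      then have "p \<in> ?I" by (simp add: space_restrict_space)
      then show "norm \<bar>f p - h n p\<bar> \<le> 1"
        using f01[of p] h01[of n p] by auto
    qed
  qed (use fm hm in auto)
  then have "(\<lambda>n. LINT p|unit_square_measure. \<bar>f p - h n p\<bar>) \<longlonglongrightarrow> 0"
    by simp
  then have "\<forall>\<^sub>F n in sequentially. (LINT p|unit_square_measure. \<bar>f p - h n p\<bar>) < e / 2"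
    using \<open>0 < e\<close> by (intro order_tendstoD(2)[of _ 0]) auto
  then obtain n where n: "(LINT p|unit_square_measure. \<bar>f p - h n p\<bar>) < e / 2"
    using eventually_happens trivial_limit_sequentially by blast
  have "compact ?I"
    by (intro compact_Times) auto
  then have "uniformly_continuous_on ?I (h n)"
    using hc continuous_on_subset by (intro compact_uniformly_continuous) blast+
  then obtain d where "0 < d" and d: "\<And>p q. p \<in> ?I \<Longrightarrow> q \<in> ?I \<Longrightarrow> dist q p < d \<Longrightarrow> dist (h n q) (h n p) < e / 2"
    unfolding uniformly_continuous_on_def using \<open>0 < e\<close> by (metis half_gt_zero)
  \<comment> \<open>Rounding down to the grid moves each coordinate by at most \<open>1 / N\<close>,
    hence the point by at most \<open>2 / N < d\<close>.\<close>
  obtain N :: nat where N: "2 / d < real N"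
    using reals_Archimedean2 by blast
  then have "0 < N"
    using \<open>0 < d\<close> by (cases N) (auto simp: field_simps)
  \<comment> \<open>Sampling at the lower left corners. Symmetry and the bounds hold for all indices
    because \<open>h n\<close> has both properties on the whole plane.\<close>
  define M where "M = (\<lambda>(a, b). h n (real a / N, real b / N))"
  have "(\<lambda>p. M (grid N (fst p), grid N (snd p))) \<in> borel_measurable unit_square_measure" (is "?M \<in> _")
    by (intro step_measurable grid_measurable)
  have near: "\<bar>x - real (grid N x) / N\<bar> \<le> 1 / N" "real (grid N x) / N \<in> unit_ivl" if "x \<in> unit_ivl" for x
  proof -
    have "real (grid N x) \<le> real N * x" "real N * x < real (grid N x) + 1"
      using that grid_eq_iff[of x N "grid N x"] by auto
    then have "real (grid N x) / N \<le> x" "x < (real (grid N x) + 1) / N"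
      using \<open>0 < N\<close> by (simp_all add: divide_le_eq less_divide_eq mult.commute)
    then show "\<bar>x - real (grid N x) / N\<bar> \<le> 1 / N"
      by (simp add: add_divide_distrib)
    show "real (grid N x) / N \<in> unit_ivl"
      using grid_le[OF that, of N] by (simp add: divide_le_eq)
  qed
  have close: "\<bar>h n p - ?M p\<bar> \<le> e / 2" if pI: "p \<in> ?I" for p
  proof -
    obtain x y where p: "p = (x, y)" "x \<in> unit_ivl" "y \<in> unit_ivl"
      using pI by auto
    have "dist p (real (grid N x) / N, real (grid N y) / N) \<le> \<bar>x - real (grid N x) / N\<bar> + \<bar>y - real (grid N y) / N\<bar>"
      unfolding p dist_Pair_Pair dist_real_def by (rule sqrt_sum_squares_le_sum_abs[THEN order_trans]) simp
    also have "\<dots> \<le> 1 / N + 1 / N"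
      by (intro add_mono near p)
    also have "\<dots> < d"
      using N \<open>0 < d\<close> \<open>0 < N\<close> by (simp add: field_simps)
    finally have "dist (h n p) (h n (real (grid N x) / N, real (grid N y) / N)) < e / 2"
      using near(2)[OF p(2)] near(2)[OF p(3)] pI by (intro d) auto
    then show ?thesis
      by (simp add: p M_def dist_real_def)
  qed
  have M01: "M p \<in> {0..1}" for p
    using h01 by (simp add: M_def case_prod_beta)
  have "(LINT p|unit_square_measure. \<bar>f p - ?M p\<bar>) \<le> (LINT p|unit_square_measure. \<bar>f p - h n p\<bar> + e / 2)"
  proof (intro integral_mono Bochner_Integration.integrable_add)
    show "\<bar>f p - ?M p\<bar> \<le> \<bar>f p - h n p\<bar> + e / 2" if "p \<in> space unit_square_measure" for p
    proof -
      have "p \<in> ?I"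
        using that by (simp add: space_restrict_space)
      from close[OF this] show ?thesis
        by linarith
    qed
    show "integrable unit_square_measure (\<lambda>p. \<bar>f p - ?M p\<bar>)"
    proof (rule integrable_unit_square_bounded[of _ 1])
      show "\<bar>\<bar>f p - ?M p\<bar>\<bar> \<le> 1" if "p \<in> ?I" for p
        using f01[OF that] M01[of "(grid N (fst p), grid N (snd p))"] by auto
    qed (use fm \<open>?M \<in> _\<close> in auto)
    show "integrable unit_square_measure (\<lambda>p. \<bar>f p - h n p\<bar>)"
    proof (rule integrable_unit_square_bounded[of _ 1])
      show "\<bar>\<bar>f p - h n p\<bar>\<bar> \<le> 1" if "p \<in> ?I" for p
        using f01[OF that] h01[of n p] by auto
    qed (use fm hm in auto)
  qed auto
  also have "\<dots> \<le> e"
  proof -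
    have "integrable unit_square_measure (\<lambda>p. \<bar>f p - h n p\<bar>)"
    proof (rule integrable_unit_square_bounded[of _ 1])
      show "\<bar>\<bar>f p - h n p\<bar>\<bar> \<le> 1" if "p \<in> ?I" for p
        using f01[OF that] h01[of n p] by auto
    qed (use fm hm in auto)
    moreover have "measure unit_square_measure (space unit_square_measure) = 1"
      using emeasure_unit_square by (simp add: measure_def space_restrict_space)
    ultimately show ?thesis
      using n by (simp add: Bochner_Integration.integral_add)
  qed
  finally have "(LINT p|unit_square_measure. \<bar>f p - ?M p\<bar>) \<le> e" .
  moreover have "M (a, b) = M (b, a)" for a b
    using hs[of n "(real a / N, real b / N)"] by (simp add: M_def)
  ultimately show ?thesis
    using \<open>0 < N\<close> M01 unfolding f_def by blast
qed

section \<open>Sorting the indices by label\<close>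

lemma sorting_permutation:
  fixes l :: "nat \<Rightarrow> nat"
  shows "\<exists>\<sigma>. \<sigma> permutes {..<N} \<and> (\<forall>a b. a \<le> b \<longrightarrow> b < N \<longrightarrow> l (\<sigma> a) \<le> l (\<sigma> b))"
proof -
  define xs where "xs = sort_key l [0..<N]"
  have xs: "length xs = N" "distinct xs" "set xs = {..<N}"
    by (auto simp: xs_def)
  define \<sigma> where "\<sigma> a = (if a < N then xs ! a else a)" for a
  have "bij_betw ((!) xs) {..<N} {..<N}"
    using xs by (intro bij_betw_nth) auto
  then have "bij_betw \<sigma> {..<N} {..<N}"
    by (subst bij_betw_cong[of _ _ "(!) xs"]) (auto simp: \<sigma>_def)
  then have "\<sigma> permutes {..<N}"
    by (rule bij_imp_permutes) (simp add: \<sigma>_def)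
  moreover have "l (\<sigma> a) \<le> l (\<sigma> b)" if "a \<le> b" "b < N" for a b
    using that sorted_nth_mono[of "map l xs" a b] xs(1) by (simp add: xs_def[symmetric] \<sigma>_def) (simp add: xs_def)
  ultimately show ?thesis by blast
qed

definition count_below :: "nat \<Rightarrow> (nat \<Rightarrow> real) \<Rightarrow> real \<Rightarrow> nat" where
  "count_below m c x = card {j \<in> {1..<m}. c j \<le> x}"

lemma count_below_measurable: "count_below m c \<in> measurable borel (count_space UNIV)"
proof -
  have "(\<lambda>x. count_below m c x) = (\<lambda>x. \<Sum>j\<in>{1..<m}. if c j \<le> x then 1 else 0)"
    by (simp add: count_below_def sum.If_cases Int_def fun_eq_iff)
  then show ?thesis
    by simp
qed

text \<open>With sorted labels the indices of label below \<open>j\<close> form an initial segment,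
  so its length is at most \<open>grid N x\<close> exactly if the label there is at least
  \<open>j\<close>. As \<open>j\<close> starts from 1, the number of such \<open>j\<close> is the
  label itself.\<close>

lemma count_below_sorted:
  assumes N: "0 < N" and mono: "\<And>a b. a \<le> b \<Longrightarrow> b < N \<Longrightarrow> l a \<le> l b"
    and bound: "\<And>a. a < N \<Longrightarrow> l a < m" and x: "x \<in> {0..<1}"
  shows "count_below m (\<lambda>j. card {b. b < N \<and> l b < j} / N) x = l (grid N x)"
proof -
  let ?a = "grid N x"
  have a: "?a < N"
    using N x by (intro grid_less) auto
  have "real (card {b. b < N \<and> l b < j}) / N \<le> x \<longleftrightarrow> j \<le> l ?a" for j
  proof -
    have "real (card {b. b < N \<and> l b < j}) / N \<le> x \<longleftrightarrow> card {b. b < N \<and> l b < j} \<le> ?a"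
      using N x grid_eq_iff[of x N ?a] by (auto simp: field_simps)
    also have "\<dots> \<longleftrightarrow> j \<le> l ?a"
    proof
      assume "j \<le> l ?a"
      then have "{b. b < N \<and> l b < j} \<subseteq> {..<?a}"
        using mono[of ?a] by (force simp: not_le[symmetric])
      then show "card {b. b < N \<and> l b < j} \<le> ?a"
        using card_mono[of "{..<?a}"] by fastforce
    next
      assume *: "card {b. b < N \<and> l b < j} \<le> ?a"
      show "j \<le> l ?a"
      proof (rule ccontr)
        assume "\<not> j \<le> l ?a"
        then have "{..?a} \<subseteq> {b. b < N \<and> l b < j}"
          using mono[of _ ?a] a by force
        then have "card {..?a} \<le> card {b. b < N \<and> l b < j}"
          by (intro card_mono) auto
        then show False
          using * by simp
      qed
    qed
    finally show ?thesis .
  qed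
  then have "count_below m (\<lambda>j. card {b. b < N \<and> l b < j} / N) x = card {j \<in> {1..<m}. j \<le> l ?a}"
    by (simp add: count_below_def)
  also have "{j \<in> {1..<m}. j \<le> l ?a} = {1..l ?a}"
    using bound[OF a] by auto
  finally show ?thesis by simp
qed

subsection \<open>Regular rearrangements\<close>

text \<open>The \<open>j\<close>-th interval starts at \<open>c j\<close> for \<open>1 \<le> j < m\<close> and at \<open>0\<close> for \<open>j = 0\<close>; counting the starting points
  keeps the definition meaningful for unsorted \<open>c\<close> and makes its dependence on \<open>c\<close> visibly continuous.\<close>

definition block_step :: "nat \<Rightarrow> (nat \<Rightarrow> real) \<Rightarrow> (nat \<Rightarrow> nat \<Rightarrow> real) \<Rightarrow> real \<times> real \<Rightarrow> real" where
  "block_step m c d = (\<lambda>(x, y). d (count_below m c x) (count_below m c y))"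

lemma block_step_measurable: "block_step m c d \<in> borel_measurable unit_square_measure"
proof -
  have "block_step m c d = (\<lambda>p. (\<lambda>(j, k). d j k) (count_below m c (fst p), count_below m c (snd p)))"
    by (auto simp: block_step_def)
  then show ?thesis
    by (simp only: step_measurable[OF count_below_measurable count_below_measurable])
qed

lemma sum_rectangle_shuffle:
  fixes D :: "'a \<times> 'a \<Rightarrow> real"
  assumes "bij_betw \<sigma> A A" "S \<subseteq> A" "T \<subseteq> A"
  shows "(\<Sum>p\<in>S\<times>T. D (map_prod \<sigma> \<sigma> p)) = (\<Sum>p\<in>(\<sigma> ` S)\<times>(\<sigma> ` T). D p)"
proof -
  have "bij_betw (map_prod \<sigma> \<sigma>) (S \<times> T) ((\<sigma> ` S) \<times> (\<sigma> ` T))"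
    using assms by (intro bij_betw_map_prod) (auto intro: bij_betw_subset)
  then show ?thesis
    by (rule sum.reindex_bij_betw)
qed

text \<open>Labels of level \<open>i\<close> have \<open>i\<close> digits in base 4, whence
  \<open>4 ^ i\<close> blocks for every graphon; this uniformity is what permits passing to limits
  of \<open>c\<close> and \<open>d\<close>. The cutoff \<open>K\<close> is the level by which the
  indices are sorted, and \<open>e\<close> absorbs the error of replacing \<open>U\<close> by a
  matrix.\<close>

definition regular_rearrangement ::
  "(real \<Rightarrow> real \<Rightarrow> real) \<Rightarrow> nat \<Rightarrow> real \<Rightarrow> (real \<Rightarrow> real \<Rightarrow> real) \<Rightarrow>
    (nat \<Rightarrow> nat \<Rightarrow> real) \<Rightarrow> (nat \<Rightarrow> nat \<Rightarrow> nat \<Rightarrow> real) \<Rightarrow> bool" where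
  "regular_rearrangement U K e V c d \<longleftrightarrow> version_of V U \<and>
    (\<forall>i j. c i j \<in> {0..1}) \<and> (\<forall>i j k. d i j k \<in> {0..1} \<and> d i j k = d i k j) \<and>
    (\<forall>i j. i \<le> j \<longrightarrow> j \<le> K \<longrightarrow>
      (LINT p|unit_square_measure. (block_step (4 ^ j) (c j) (d j) p - block_step (4 ^ i) (c i) (d i) p)\<^sup>2) =
      (LINT p|unit_square_measure. (block_step (4 ^ j) (c j) (d j) p)\<^sup>2) -
      (LINT p|unit_square_measure. (block_step (4 ^ i) (c i) (d i) p)\<^sup>2)) \<and>
    (\<forall>i<K. \<forall>A\<in>sets (lebesgue_on unit_ivl).
      \<bar>LINT p|unit_square_measure. indicator A (fst p) * indicator A (snd p) *
        ((\<lambda>(x, y). V x y) p - block_step (4 ^ i) (c i) (d i) p)\<bar> \<le>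
      sqrt ((LINT p|unit_square_measure. (block_step (4 ^ Suc i) (c (Suc i)) (d (Suc i)) p)\<^sup>2) -
        (LINT p|unit_square_measure. (block_step (4 ^ i) (c i) (d i) p)\<^sup>2)) + e)"

text \<open>Sorting by the labels of level \<open>K\<close> sorts all coarser levels too, so one
  permutation turns the blocks of every level up to \<open>K\<close> into rectangles of intervals.
  The greedy bound on index rectangles then passes to measurable sets through fractional
  weights.\<close>

lemma graphon_rearrangement:
  assumes U: "graphon U" and e: "0 < e"
  shows "\<exists>V c d. regular_rearrangement U K e V c d"
proof -
  let ?M2 = unit_square_measure
  obtain N M where N: "0 < N" and Ms: "\<And>a b. M (a, b) = M (b, a)" and M01: "\<And>p. M p \<in> {0..1}"
    and approx: "(LINT p|?M2. \<bar>(\<lambda>(x, y). U x y) p - M (grid N (fst p), grid N (snd p))\<bar>) \<le> e"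
    using graphon_step_approximation[OF U e] by blast
  define X where "X = {..<N} \<times> {..<N}"
  define L where "L = (\<lambda>l :: nat \<Rightarrow> nat. \<lambda>(a, b). (l a, l b))"
  define Q where "Q = (\<lambda>l p. cell_avg X (L l) M (L l p))"
  obtain l where l0: "\<And>a. l 0 a = 0" and ldiv: "\<And>i a. l (Suc i) a div 4 = l i a"
    and greedy: "\<And>i S T. S \<subseteq> {..<N} \<Longrightarrow> T \<subseteq> {..<N} \<Longrightarrow>
      (\<Sum>p\<in>S\<times>T. M p - Q (l i) p)\<^sup>2 \<le> real (card X) * ((\<Sum>p\<in>X. (Q (l (Suc i)) p)\<^sup>2) - (\<Sum>p\<in>X. (Q (l i) p)\<^sup>2))"
    using greedy_labels[of N M] unfolding X_def L_def Q_def by blast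
  have finX: "finite X" and cardX: "real (card X) = (real N)\<^sup>2"
    by (auto simp: X_def power2_eq_square)
  have div_pow: "l i a = l (i + n) a div 4 ^ n" for i n a
  proof (induction n)
    case (Suc n)
    have "l (i + Suc n) a div 4 ^ Suc n = l (Suc (i + n)) a div 4 div 4 ^ n"
      by (simp add: div_mult2_eq)
    then show ?case
      using Suc ldiv by simp
  qed simp
  have l_bound: "l i a < 4 ^ i" for i a
  proof (induction i)
    case (Suc i)
    then have "l (Suc i) a div 4 < 4 ^ i"
      by (simp add: ldiv)
    then show ?case
      by (simp add: div_less_iff_less_mult mult.commute)
  qed (simp add: l0)
  obtain \<sigma> where \<sigma>: "\<sigma> permutes {..<N}" and sorted: "\<And>a b. a \<le> b \<Longrightarrow> b < N \<Longrightarrow> l K (\<sigma> a) \<le> l K (\<sigma> b)"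
    using sorting_permutation[of N "l K"] by blast
  have bij: "bij_betw \<sigma> {..<N} {..<N}"
    using \<sigma> by (rule permutes_imp_bij)
  have mono: "l i (\<sigma> a) \<le> l i (\<sigma> b)" if "i \<le> K" "a \<le> b" "b < N" for i a b
    \<comment> \<open>Coarser labels arise by dividing by a power of 4, which is monotone.\<close>
    using sorted[OF that(2,3)] div_pow[of i _ "K - i"] that(1) by (simp add: div_le_mono)
  define V where "V = (\<lambda>x y. U (shuffle N \<sigma> x) (shuffle N \<sigma> y))"
  \<comment> \<open>After sorting, the indices with label below \<open>j\<close> occupy exactly the
    part of the interval to the left of this point.\<close>
  define c where "c i j = card {b. b < N \<and> l i (\<sigma> b) < j} / N" for i j
  define d where "d i j k = cell_avg X (L (l i)) M (j, k)" for i j k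
  define G where "G i = block_step (4 ^ i) (c i) (d i)" for i
  define D where "D i p = Q (l i) (map_prod \<sigma> \<sigma> p)" for i p
  define H where "H p = M (map_prod \<sigma> \<sigma> (grid N (fst p), grid N (snd p)))" for p
  have version: "version_of V U"
    unfolding V_def by (rule version_of_shuffle[OF U N \<sigma>])
  have c01: "c i j \<in> {0..1}" for i j
  proof -
    have "card {b. b < N \<and> l i (\<sigma> b) < j} \<le> card {..<N}"
      by (intro card_mono) auto
    then show ?thesis
      using N by (simp add: c_def divide_le_eq)
  qed
  have d01: "d i j k \<in> {0..1}" for i j k
    unfolding d_def by (rule cell_avg_mem_unit[OF M01])
  have d_sym: "d i j k = d i k j" for i j k
    unfolding d_def X_def L_def by (rule cell_avg_swap) (rule Ms)
  have Gm: "G i \<in> borel_measurable ?M2" for i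
    unfolding G_def by (rule block_step_measurable)
  have G01: "G i p \<in> {0..1}" for i p
    using d01 by (simp add: G_def block_step_def case_prod_beta)
  have G_eq: "G i (x, y) = D i (grid N x, grid N y)" if "i \<le> K" "x \<in> {0..<1}" "y \<in> {0..<1}" for i x y
  proof -
    have "count_below (4 ^ i) (c i) z = l i (\<sigma> (grid N z))" if "z \<in> {0..<1}" for z
      using count_below_sorted[OF N mono[OF \<open>i \<le> K\<close>] l_bound that] by (simp add: c_def[abs_def])
    then show ?thesis
      using that by (simp add: G_def block_step_def D_def Q_def d_def L_def)
  qed
  have sum_perm: "(\<Sum>p\<in>X. F (map_prod \<sigma> \<sigma> p)) = (\<Sum>p\<in>X. F p)" for F :: "_ \<Rightarrow> real"
    using sum_rectangle_shuffle[OF bij, of "{..<N}" "{..<N}" F] permutes_image[OF \<sigma>] by (simp add: X_def)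
  have int_sq: "(LINT p|?M2. (G i p)\<^sup>2) = (\<Sum>p\<in>X. (Q (l i) p)\<^sup>2) / (real N)\<^sup>2" if "i \<le> K" for i
  proof -
    have "(LINT p|?M2. (G i p)\<^sup>2) = (\<Sum>p\<in>X. (D i p)\<^sup>2) / (real N)\<^sup>2"
      unfolding X_def using Gm that by (intro integral_step N) (auto simp: G_eq)
    then show ?thesis
      unfolding D_def sum_perm[of "\<lambda>p. (Q (l i) p)\<^sup>2"] .
  qed
  have energy: "(\<Sum>p\<in>X. (Q (l i) p)\<^sup>2) = (real N)\<^sup>2 * (LINT p|?M2. (G i p)\<^sup>2)" if "i \<le> K" for i
    using int_sq[OF that] N by simp
  have pyth: "(LINT p|?M2. (G j p - G i p)\<^sup>2) = (LINT p|?M2. (G j p)\<^sup>2) - (LINT p|?M2. (G i p)\<^sup>2)"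
    if "i \<le> j" "j \<le> K" for i j
  proof -
    have "i \<le> K"
      using that by simp
    define r :: "nat \<times> nat \<Rightarrow> nat \<times> nat" where "r = map_prod (\<lambda>k. k div 4 ^ (j - i)) (\<lambda>k. k div 4 ^ (j - i))"
    have Lr: "L (l i) = (\<lambda>p. r (L (l j) p))"
      using div_pow[of i _ "j - i"] \<open>i \<le> j\<close> by (auto simp: L_def r_def fun_eq_iff)
    have "(LINT p|?M2. (G j p - G i p)\<^sup>2) = (\<Sum>p\<in>X. (D j p - D i p)\<^sup>2) / (real N)\<^sup>2"
      unfolding X_def using Gm that \<open>i \<le> K\<close> by (intro integral_step N) (auto simp: G_eq)
    also have "(\<Sum>p\<in>X. (D j p - D i p)\<^sup>2) = (\<Sum>p\<in>X. (Q (l j) p - Q (l i) p)\<^sup>2)"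
      unfolding D_def by (rule sum_perm)
    also have "\<dots> = (\<Sum>p\<in>X. (Q (l j) p)\<^sup>2) - (\<Sum>p\<in>X. (Q (l i) p)\<^sup>2)"
      unfolding Q_def Lr by (rule cell_avg_pythagoras[OF finX])
    finally show ?thesis
      using int_sq \<open>i \<le> K\<close> that by (simp add: diff_divide_distrib)
  qed
  have Hm: "H \<in> borel_measurable ?M2"
    unfolding H_def by (rule step_measurable[where D = "\<lambda>p. M (map_prod \<sigma> \<sigma> p)"]) (rule grid_measurable)+
  have Vm: "(\<lambda>(x, y). V x y) \<in> borel_measurable ?M2" and V01: "\<And>x y. x \<in> unit_ivl \<Longrightarrow> y \<in> unit_ivl \<Longrightarrow> V x y \<in> {0..1}"
    using version by (simp_all add: version_of_def graphon_def)
  \<comment> \<open>The shuffle preserves the measure of the square, so \<open>V\<close> is as close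
    to the permuted matrix as \<open>U\<close> is to the original one.\<close>
  have VH: "(LINT p|?M2. \<bar>(\<lambda>(x, y). V x y) p - H p\<bar>) \<le> e"
  proof -
    define f where "f p = \<bar>(\<lambda>(x, y). U x y) p - M (grid N (fst p), grid N (snd p))\<bar>" for p
    have "f \<in> borel_measurable ?M2"
      unfolding f_def using U step_measurable[OF grid_measurable grid_measurable, of M]
      by (intro borel_measurable_abs borel_measurable_diff) (simp_all add: graphon_def)
    then have "(LINT p|?M2. f (map_prod (shuffle N \<sigma>) (shuffle N \<sigma>) p)) = integral\<^sup>L ?M2 f"
      by (rule integral_shuffle_square[OF N \<sigma>])
    moreover have "(LINT p|?M2. \<bar>(\<lambda>(x, y). V x y) p - H p\<bar>) = (LINT p|?M2. f (map_prod (shuffle N \<sigma>) (shuffle N \<sigma>) p))"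
      by (intro Bochner_Integration.integral_cong)
        (auto simp: f_def H_def V_def space_restrict_space grid_shuffle(2)[OF N \<sigma>])
    moreover have "integral\<^sup>L ?M2 f \<le> e"
      using approx unfolding f_def .
    ultimately show ?thesis
      by linarith
  qed
  have reg: "\<bar>LINT p|?M2. indicator A (fst p) * indicator A (snd p) * ((\<lambda>(x, y). V x y) p - G i p)\<bar> \<le>
      sqrt ((LINT p|?M2. (G (Suc i) p)\<^sup>2) - (LINT p|?M2. (G i p)\<^sup>2)) + e"
    if "i < K" and A: "A \<in> sets (lebesgue_on unit_ivl)" for i A
  proof -
    have iK: "i \<le> K" "Suc i \<le> K"
      using that by auto
    let ?\<delta> = "(LINT p|?M2. (G (Suc i) p)\<^sup>2) - (LINT p|?M2. (G i p)\<^sup>2)"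
    have H01: "H p \<in> {0..1}" for p
      using M01 by (simp add: H_def)
    have int1: "integrable ?M2 (\<lambda>p. (\<lambda>(x, y). V x y) p - H p)"
    proof (rule integrable_unit_square_bounded[of _ 1])
      show "\<bar>(\<lambda>(x, y). V x y) p - H p\<bar> \<le> 1" if "p \<in> unit_ivl \<times> unit_ivl" for p
        using H01[of p] V01[of "fst p" "snd p"] that by (auto simp: case_prod_beta)
    qed (use Vm Hm in auto)
    have int2: "integrable ?M2 (\<lambda>p. H p - G i p)"
    proof (rule integrable_unit_square_bounded[of _ 1])
      show "\<bar>H p - G i p\<bar> \<le> 1" for p
        using H01[of p] G01[of i p] by auto
    qed (use Gm Hm in auto)
    have ind: "integrable ?M2 (\<lambda>p. indicator A (fst p) * indicator A (snd p) * f p)"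
      if "integrable ?M2 f" for f :: "_ \<Rightarrow> real"
      using that indicator_rectangle_measurable[OF A]
      by (intro Bochner_Integration.integrable_bound[OF that]) (auto simp: indicator_def intro!: AE_I2)
    have "(LINT p|?M2. indicator A (fst p) * indicator A (snd p) * ((\<lambda>(x, y). V x y) p - G i p)) =
      (LINT p|?M2. indicator A (fst p) * indicator A (snd p) * ((\<lambda>(x, y). V x y) p - H p) +
        indicator A (fst p) * indicator A (snd p) * (H p - G i p))"
      by (intro Bochner_Integration.integral_cong refl) (simp add: algebra_simps)
    also have "\<dots> = (LINT p|?M2. indicator A (fst p) * indicator A (snd p) * ((\<lambda>(x, y). V x y) p - H p)) +
        (LINT p|?M2. indicator A (fst p) * indicator A (snd p) * (H p - G i p))"
      by (rule Bochner_Integration.integral_add[OF ind[OF int1] ind[OF int2]])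
    finally have split: "(LINT p|?M2. indicator A (fst p) * indicator A (snd p) * ((\<lambda>(x, y). V x y) p - G i p)) =
        (LINT p|?M2. indicator A (fst p) * indicator A (snd p) * ((\<lambda>(x, y). V x y) p - H p)) +
        (LINT p|?M2. indicator A (fst p) * indicator A (snd p) * (H p - G i p))" .
    have first: "\<bar>LINT p|?M2. indicator A (fst p) * indicator A (snd p) * ((\<lambda>(x, y). V x y) p - H p)\<bar> \<le> e"
      using rectangle_integral_le[OF int1 A] VH by linarith
    define E where "E p = M (map_prod \<sigma> \<sigma> p) - D i p" for p
    \<comment> \<open>The fraction of the cell that \<open>A\<close> fills.\<close>
    define w where "w a = N * measure lebesgue (A \<inter> grid_cell N a)" for a
    have w: "w a \<in> {0..1}" if "a \<in> {..<N}" for a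
    proof -
      have "grid_cell N a \<in> lmeasurable"
        by (intro bounded_set_imp_lmeasurable grid_cell_lebesgue bounded_subset[OF bounded_closed_interval[of 0 1]])
          (auto simp: grid_cell_def)
      then have "measure lebesgue (A \<inter> grid_cell N a) \<le> 1 / N"
        using A that by (subst measure_grid_cell[symmetric]) (auto intro!: measure_mono_fmeasurable simp: sets_restrict_space_iff)
      then show ?thesis
        using N by (simp add: w_def field_simps)
    qed
    have rect: "\<bar>\<Sum>p\<in>S\<times>T. E p\<bar> \<le> (real N)\<^sup>2 * sqrt ?\<delta>" if "S \<subseteq> {..<N}" "T \<subseteq> {..<N}" for S T
    proof -
      have "\<sigma> ` S \<subseteq> {..<N}" "\<sigma> ` T \<subseteq> {..<N}"
        using that bij by (auto simp: bij_betw_def)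
      then have "(\<Sum>p\<in>(\<sigma> ` S)\<times>(\<sigma> ` T). M p - Q (l i) p)\<^sup>2 \<le>
          real (card X) * ((\<Sum>p\<in>X. (Q (l (Suc i)) p)\<^sup>2) - (\<Sum>p\<in>X. (Q (l i) p)\<^sup>2))"
        by (rule greedy)
      also have "(\<Sum>p\<in>(\<sigma> ` S)\<times>(\<sigma> ` T). M p - Q (l i) p) = (\<Sum>p\<in>S\<times>T. E p)"
        unfolding E_def D_def
        using sum_rectangle_shuffle[OF bij that, of "\<lambda>p. M p - Q (l i) p"] by simp
      \<comment> \<open>The factor \<open>card X\<close> and the passage from sums to integrals
        contribute \<open>(real N)\<^sup>2\<close> each. After the square root one such factor is
        left, which cancels the cell measures below.\<close>
      also have "real (card X) * ((\<Sum>p\<in>X. (Q (l (Suc i)) p)\<^sup>2) - (\<Sum>p\<in>X. (Q (l i) p)\<^sup>2)) = ((real N)\<^sup>2)\<^sup>2 * ?\<delta>"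
        by (simp only: energy[OF iK(1)] energy[OF iK(2)] cardX power2_eq_square[of "(real N)\<^sup>2"] right_diff_distrib mult.assoc)
      finally have "sqrt ((\<Sum>p\<in>S\<times>T. E p)\<^sup>2) \<le> sqrt (((real N)\<^sup>2)\<^sup>2 * ?\<delta>)"
        by (rule real_sqrt_le_mono)
      then show ?thesis
        unfolding real_sqrt_mult real_sqrt_abs by simp
    qed
    have "(LINT p|?M2. indicator A (fst p) * indicator A (snd p) * (H p - G i p)) =
      (\<Sum>a<N. \<Sum>b<N. measure lebesgue (A \<inter> grid_cell N a) * measure lebesgue (A \<inter> grid_cell N b) * E (a, b))"
    proof (rule rectangle_integral_step[OF N _ _ A])
      show "(\<lambda>p. H p - G i p) \<in> borel_measurable ?M2"
        using Hm Gm by (rule borel_measurable_diff)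
      show "H (x, y) - G i (x, y) = E (grid N x, grid N y)" if "x \<in> {0..<1}" "y \<in> {0..<1}" for x y
        using G_eq[OF iK(1) that] by (simp add: H_def E_def)
    qed
    also have "\<dots> = (\<Sum>a<N. \<Sum>b<N. w a * w b * E (a, b)) / (real N)\<^sup>2"
      using N by (simp add: w_def sum_divide_distrib power2_eq_square mult.assoc)
    also have "\<bar>\<dots>\<bar> \<le> sqrt ?\<delta>"
      using bilinear_unit_weights_le[OF finite_lessThan finite_lessThan rect w w] N
      by (simp add: abs_divide divide_le_eq mult.commute)
    finally show ?thesis
      using split first by linarith
  qed
  show ?thesis
    using version c01 d01 d_sym pyth reg unfolding regular_rearrangement_def G_def by blast
qed

subsection \<open>Limits of block averages\<close>

lemma bounded_family_diagonal_subsequence: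
  fixes f :: "nat \<Rightarrow> 'b::countable \<Rightarrow> real"
  assumes "\<And>n x. f n x \<in> {a..b}"
  shows "\<exists>r. strict_mono r \<and> (\<forall>x. convergent (\<lambda>n. f (r n) x))"
proof -
  let ?P = "\<lambda>m s. convergent (\<lambda>k. f (s k) (from_nat m))"
  interpret subseqs ?P
  proof
    fix m and s :: "nat \<Rightarrow> nat"
    have "seq_compact {a..b}"
      by (intro compact_imp_seq_compact compact_Icc)
    then obtain l r where "strict_mono r" "((\<lambda>k. f (s k) (from_nat m)) \<circ> r) \<longlonglongrightarrow> l"
      using assms by (elim seq_compactE[of _ "\<lambda>k. f (s k) (from_nat m)"]) auto
    then show "\<exists>r. strict_mono r \<and> ?P m (s \<circ> r)"
      by (auto simp: convergent_def o_def)
  qed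
  have "convergent (\<lambda>n. f (diagseq n) x)" for x
  proof -
    \<comment> \<open>The diagonal sequence is a subsequence of the one chosen for \<open>x\<close>
      only from this index on, hence the shift.\<close>
    have "?P (to_nat x) (diagseq \<circ> (+) (Suc (to_nat x)))"
    proof (rule diagseq_holds)
      show "?P m (s \<circ> r)" if "strict_mono r" "?P m s" for m s and r :: "nat \<Rightarrow> nat"
        using convergent_subseq_convergent[OF that(2,1)] by (simp add: o_def)
    qed
    then have "convergent (\<lambda>n. f (diagseq (n + Suc (to_nat x))) x)"
      by (simp add: o_def add.commute)
    then show ?thesis
      using convergent_ignore_initial_segment[of "\<lambda>n. f (diagseq n) x"] by blast
  qed
  then show ?thesis
    using subseq_diagseq by blast
qed

text \<open>As \<open>x\<close> differs from every limit \<open>c' j\<close>, each comparison of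
  \<open>c n j\<close> with \<open>x\<close> is eventually constant, and only finitely many
  comparisons enter the count.\<close>

lemma eventually_count_below_eq:
  assumes c: "\<And>j. (\<lambda>n. c n j) \<longlonglongrightarrow> c' j" and x: "x \<notin> range c'"
  shows "\<forall>\<^sub>F n in sequentially. count_below m (c n) x = count_below m c' x"
proof -
  have "\<forall>\<^sub>F n in sequentially. \<forall>j\<in>{1..<m}. c n j \<le> x \<longleftrightarrow> c' j \<le> x"
  proof (intro eventually_ball_finite ballI)
    fix j
    show "\<forall>\<^sub>F n in sequentially. c n j \<le> x \<longleftrightarrow> c' j \<le> x"
    proof (cases "c' j < x")
      case True
      then show ?thesis
        using order_tendstoD(2)[OF c True] by (auto elim: eventually_mono)
    next
      case False
      with x have gt: "x < c' j"
        by (metis linorder_neqE rangeI)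
      show ?thesis
        using order_tendstoD(1)[OF c gt] gt by (auto elim: eventually_mono)
    qed
  qed simp
  then show ?thesis
    unfolding count_below_def by eventually_elim (metis (mono_tags, lifting) Collect_cong)
qed

text \<open>The block containing \<open>p\<close> is eventually fixed, so only the convergence of a
  single value of \<open>d\<close> remains.\<close>

lemma block_step_tendsto:
  assumes c: "\<And>j. (\<lambda>n. c n j) \<longlonglongrightarrow> c' j" and d: "\<And>j k. (\<lambda>n. d n j k) \<longlonglongrightarrow> d' j k"
    and p: "fst p \<notin> range c'" "snd p \<notin> range c'"
  shows "(\<lambda>n. block_step m (c n) (d n) p) \<longlonglongrightarrow> block_step m c' d' p"
proof -
  have "\<forall>\<^sub>F n in sequentially. d n (count_below m c' (fst p)) (count_below m c' (snd p)) = block_step m (c n) (d n) p"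
    using eventually_count_below_eq[OF c p(1), where m = m] eventually_count_below_eq[OF c p(2), where m = m]
    by eventually_elim (simp add: block_step_def case_prod_beta)
  then show ?thesis
    using Lim_transform_eventually[OF d[of "count_below m c' (fst p)" "count_below m c' (snd p)"]]
    by (simp add: block_step_def case_prod_beta)
qed

lemma AE_unit_square_avoid_countable:
  assumes "countable C"
  shows "AE p in unit_square_measure. fst p \<notin> C \<and> snd p \<notin> C"
proof -
  have "C \<in> null_sets lborel"
    using assms by (rule countable_imp_null_set_lborel)
  then have "AE x in lebesgue. x \<notin> C"
    by (intro AE_completion AE_not_in)
  then have "AE p in (lebesgue :: (real \<times> real) measure). fst p \<notin> C \<and> snd p \<notin> C"
    by (intro AE_conjI AE_lebesgue_fst AE_lebesgue_snd)
  then have "AE p in lebesgue. p \<in> unit_ivl \<times> unit_ivl \<longrightarrow> fst p \<notin> C \<and> snd p \<notin> C"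
    by eventually_elim blast
  then show ?thesis
    by (subst AE_restrict_space_iff) (assumption | simp)+
qed

text \<open>The sum of the absolute increments has finite integral, hence is finite almost
  everywhere; there the telescoping series converges.\<close>

lemma AE_convergent_of_summable_L1:
  fixes F :: "nat \<Rightarrow> 'a \<Rightarrow> real"
  assumes int: "\<And>n. integrable M (F n)"
    and le: "\<And>n. (LINT x|M. \<bar>F (Suc n) x - F n x\<bar>) \<le> a n" and a: "summable a"
  shows "AE x in M. convergent (\<lambda>n. F n x)"
proof -
  have a0: "0 \<le> a n" for n
    using le[of n] by (rule order_trans[rotated]) simp
  have "(\<integral>\<^sup>+x. (\<Sum>n. ennreal \<bar>F (Suc n) x - F n x\<bar>) \<partial>M) = (\<Sum>n. \<integral>\<^sup>+x. ennreal \<bar>F (Suc n) x - F n x\<bar> \<partial>M)"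
    using int by (intro nn_integral_suminf) auto
  also have "\<dots> \<le> (\<Sum>n. ennreal (a n))"
  proof (rule suminf_le)
    show "(\<integral>\<^sup>+x. ennreal \<bar>F (Suc n) x - F n x\<bar> \<partial>M) \<le> ennreal (a n)" for n
      using le[of n] int by (subst nn_integral_eq_integral) (auto intro: ennreal_leI)
  qed auto
  also have "\<dots> < \<infinity>"
    using a a0 by (simp add: suminf_ennreal2)
  finally have "(\<integral>\<^sup>+x. (\<Sum>n. ennreal \<bar>F (Suc n) x - F n x\<bar>) \<partial>M) \<noteq> \<infinity>"
    by simp
  moreover have "(\<lambda>x. \<Sum>n. ennreal \<bar>F (Suc n) x - F n x\<bar>) \<in> borel_measurable M"
    using int by measurable
  ultimately have "AE x in M. (\<Sum>n. ennreal \<bar>F (Suc n) x - F n x\<bar>) \<noteq> \<infinity>"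
    by (intro nn_integral_PInf_AE)
  then show ?thesis
  proof eventually_elim
    case (elim x)
    then have "summable (\<lambda>n. \<bar>F (Suc n) x - F n x\<bar>)"
      by (intro summable_suminf_not_top) auto
    then have "convergent (\<lambda>n. \<Sum>i<n. F (Suc i) x - F i x)"
      using summable_rabs_cancel summable_iff_convergent by blast
    then have "convergent (\<lambda>n. F n x - F 0 x)"
      using sum_lessThan_telescope[of "\<lambda>i. F i x"] by simp
    then show ?case
      using convergent_add[OF _ convergent_const[of "F 0 x"]] by force
  qed
qed

text \<open>The variance of the absolute value of \<open>f\<close> on the square, a probability
  space, is nonnegative.\<close>

lemma integral_abs_le_sqrt:
  fixes f :: "real \<times> real \<Rightarrow> real"
  assumes f: "f \<in> borel_measurable unit_square_measure" and bound: "\<And>p. p \<in> unit_ivl \<times> unit_ivl \<Longrightarrow> \<bar>f p\<bar> \<le> B"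
  shows "(LINT p|unit_square_measure. \<bar>f p\<bar>) \<le> sqrt (LINT p|unit_square_measure. (f p)\<^sup>2)"
proof -
  define m where "m = (LINT p|unit_square_measure. \<bar>f p\<bar>)"
  have int1: "integrable unit_square_measure (\<lambda>p. \<bar>f p\<bar>)"
    using integrable_unit_square_bounded[OF f bound] by simp
  have int2: "integrable unit_square_measure (\<lambda>p. (f p)\<^sup>2)"
  proof (rule integrable_unit_square_bounded[of _ "B\<^sup>2"])
    show "\<bar>(f p)\<^sup>2\<bar> \<le> B\<^sup>2" if "p \<in> unit_ivl \<times> unit_ivl" for p
      using bound[OF that] by (simp add: abs_le_square_iff[symmetric])
  qed (use f in auto)
  have one: "measure unit_square_measure (space unit_square_measure) = 1"
    using emeasure_unit_square by (simp add: measure_def space_restrict_space)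
  have "0 \<le> (LINT p|unit_square_measure. (\<bar>f p\<bar> - m)\<^sup>2)"
    by simp
  also have "\<dots> = (LINT p|unit_square_measure. (f p)\<^sup>2 + m\<^sup>2 - 2 * m * \<bar>f p\<bar>)"
    by (intro Bochner_Integration.integral_cong refl) (simp add: power2_diff)
  also have "\<dots> = (LINT p|unit_square_measure. (f p)\<^sup>2) + m\<^sup>2 - 2 * m * m"
    using int1 int2 one by (simp add: m_def)
  finally have "m\<^sup>2 \<le> (LINT p|unit_square_measure. (f p)\<^sup>2)"
    by (simp add: power2_eq_square)
  then show ?thesis
    unfolding m_def by (rule real_le_rsqrt)
qed

subsection \<open>Compactness\<close>

theorem theorem2:
  fixes \<Gamma> :: "nat \<Rightarrow> real \<Rightarrow> real \<Rightarrow> real"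
  assumes "\<And>n. graphon (\<Gamma> n)"
  shows "\<exists>(k :: nat \<Rightarrow> nat) (\<Gamma>' :: nat \<Rightarrow> real \<Rightarrow> real \<Rightarrow> real) (W :: real \<Rightarrow> real \<Rightarrow> real).
           strict_mono k \<and>
           (\<forall>n. version_of (\<Gamma>' n) (\<Gamma> (k n))) \<and>
           graphon W \<and>
           (\<lambda>n. cut_norm (\<lambda>x y. \<Gamma>' n x y - W x y)) \<longlonglongrightarrow> 0"
proof -
  let ?M2 = unit_square_measure and ?I = "unit_ivl \<times> unit_ivl"
  let ?B = "\<lambda>c d n i. block_step (4 ^ i) (c n i) (d n i)"
  \<comment> \<open>The \<open>n\<close>-th graphon is handled up to level \<open>n\<close> with
    error \<open>1 / (n + 1)\<close>: every fixed level is eventually available, and the error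
    vanishes.\<close>
  have "\<forall>n. \<exists>V c d. regular_rearrangement (\<Gamma> n) n (inverse (real (Suc n))) V c d"
    by (intro allI graphon_rearrangement assms) simp
  then obtain V c d where Vcd: "\<And>n. regular_rearrangement (\<Gamma> n) n (inverse (real (Suc n))) (V n) (c n) (d n)"
    by metis
  note Vcd = Vcd[unfolded regular_rearrangement_def]
  have version: "version_of (V n) (\<Gamma> n)" for n
    using Vcd[of n] by (elim conjE)
  have c01: "c n i j \<in> {0..1}" and d01: "d n i j k \<in> {0..1}" and d_sym: "d n i j k = d n i k j" for n i j k
    using Vcd[of n] by blast+
  have pyth: "(LINT p|?M2. (?B c d n j p - ?B c d n i p)\<^sup>2) =
      (LINT p|?M2. (?B c d n j p)\<^sup>2) - (LINT p|?M2. (?B c d n i p)\<^sup>2)" if "i \<le> j" "j \<le> n" for n i j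
    using Vcd[of n] that by blast
  have reg: "\<bar>LINT p|?M2. indicator A (fst p) * indicator A (snd p) * ((\<lambda>(x, y). V n x y) p - ?B c d n i p)\<bar> \<le>
      sqrt ((LINT p|?M2. (?B c d n (Suc i) p)\<^sup>2) - (LINT p|?M2. (?B c d n i p)\<^sup>2)) + inverse (real (Suc n))"
    if "i < n" "A \<in> sets (lebesgue_on unit_ivl)" for n i A
    using Vcd[of n] that by blast
  \<comment> \<open>The flag merges both families into one over a countable index type, so that a
    single diagonal argument serves all levels.\<close>
  define f where "f n = (\<lambda>(b, i, j, k). if b then c n i j else d n i j k)" for n
  have "f n x \<in> {0..1}" for n x
    using c01 d01 by (cases x) (auto simp: f_def)
  then obtain r :: "nat \<Rightarrow> nat" where r: "strict_mono r" and conv: "\<And>x. convergent (\<lambda>n. f (r n) x)"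
    using bounded_family_diagonal_subsequence by blast
  have conv_c: "convergent (\<lambda>n. c (r n) i j)" and conv_d: "convergent (\<lambda>n. d (r n) i j k)" for i j k
    using conv[of "(True, i, j, 0)"] conv[of "(False, i, j, k)"] by (auto simp: f_def)
  define c' where "c' i j = lim (\<lambda>n. c (r n) i j)" for i j
  define d' where "d' i j k = lim (\<lambda>n. d (r n) i j k)" for i j k
  have c_lim: "(\<lambda>n. c (r n) i j) \<longlonglongrightarrow> c' i j" and d_lim: "(\<lambda>n. d (r n) i j k) \<longlonglongrightarrow> d' i j k" for i j k
    using conv_c conv_d by (simp_all add: c'_def d'_def convergent_LIMSEQ_iff)
  define G where "G n i = ?B c d (r n) i" for n i
  define W where "W i = block_step (4 ^ i) (c' i) (d' i)" for i
  have d'01: "d' i j k \<in> {0..1}" for i j k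
    using d01 by (intro Lim_in_closed_set[OF closed_atLeastAtMost _ _ d_lim]) auto
  have Gm [measurable]: "G n i \<in> borel_measurable ?M2" and Wm [measurable]: "W i \<in> borel_measurable ?M2" for n i
    unfolding G_def W_def by (rule block_step_measurable)+
  have G01: "G n i p \<in> {0..1}" and W01: "W i p \<in> {0..1}" for n i p
    using d01 d'01 unfolding G_def W_def block_step_def case_prod_beta by blast+
  have W_sym: "W i (x, y) = W i (y, x)" for i x y
    using d_sym by (simp add: W_def block_step_def d'_def)
  have GW: "AE p in ?M2. (\<lambda>n. G n i p) \<longlonglongrightarrow> W i p" for i
  proof -
    \<comment> \<open>Convergence can fail only where a coordinate equals a limiting starting point,
      which leaves countably many lines.\<close>
    have "countable (range (c' i))" by simp
    from AE_unit_square_avoid_countable[OF this] show ?thesis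
    proof eventually_elim
      case (elim p)
      then show ?case
        unfolding G_def W_def by (intro block_step_tendsto c_lim d_lim) auto
    qed
  qed
  have dominated: "(\<lambda>n. integral\<^sup>L ?M2 (u n)) \<longlonglongrightarrow> integral\<^sup>L ?M2 v"
    if "\<And>n. u n \<in> borel_measurable ?M2" "v \<in> borel_measurable ?M2" "\<And>n p. \<bar>u n p\<bar> \<le> 1"
      "AE p in ?M2. (\<lambda>n. u n p) \<longlonglongrightarrow> v p"
    for u :: "nat \<Rightarrow> real \<times> real \<Rightarrow> real" and v :: "real \<times> real \<Rightarrow> real"
    using that by (intro integral_dominated_convergence[where w = "\<lambda>_. 1"]) auto
  define E where "E i = (LINT p|?M2. (W i p)\<^sup>2)" for i
  have sq01: "\<bar>(G n i p)\<^sup>2\<bar> \<le> 1" "(W i p)\<^sup>2 \<le> 1" for n i p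
    using G01[of n i p] W01[of i p] by (auto simp: power_le_one)
  have energy: "(\<lambda>n. LINT p|?M2. (G n i p)\<^sup>2) \<longlonglongrightarrow> E i" for i
    unfolding E_def
  proof (rule dominated)
    show "AE p in ?M2. (\<lambda>n. (G n i p)\<^sup>2) \<longlonglongrightarrow> (W i p)\<^sup>2"
      using GW[of i] by eventually_elim (rule tendsto_power)
  qed (use sq01 in auto)
  have W_diff: "(LINT p|?M2. (W j p - W i p)\<^sup>2) = E j - E i" if "i \<le> j" for i j
  proof (rule LIMSEQ_unique)
    show "(\<lambda>n. LINT p|?M2. (G n j p - G n i p)\<^sup>2) \<longlonglongrightarrow> (LINT p|?M2. (W j p - W i p)\<^sup>2)"
    proof (rule dominated)
      show "\<bar>(G n j p - G n i p)\<^sup>2\<bar> \<le> 1" for n p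
        using G01[of n j p] G01[of n i p] by (auto simp: abs_square_le_1 abs_le_iff)
      show "AE p in ?M2. (\<lambda>n. (G n j p - G n i p)\<^sup>2) \<longlonglongrightarrow> (W j p - W i p)\<^sup>2"
        using GW[of i] GW[of j] by eventually_elim (intro tendsto_intros)
    qed auto
    have "\<forall>\<^sub>F n in sequentially. (LINT p|?M2. (G n j p)\<^sup>2) - (LINT p|?M2. (G n i p)\<^sup>2) = (LINT p|?M2. (G n j p - G n i p)\<^sup>2)"
      using eventually_ge_at_top[of j]
    proof eventually_elim
      case (elim n)
      \<comment> \<open>The orthogonality relation for the graphon \<open>r n\<close> covers levels
        up to \<open>r n\<close> only, so it enters the limit for large \<open>n\<close>.\<close>
      then have "j \<le> r n"
        using seq_suble[OF r, of n] by linarith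
      then show ?case
        unfolding G_def by (rule pyth[OF that, symmetric])
    qed
    then show "(\<lambda>n. LINT p|?M2. (G n j p - G n i p)\<^sup>2) \<longlonglongrightarrow> E j - E i"
      by (rule Lim_transform_eventually[rotated]) (intro tendsto_diff energy)
  qed
  have W_le1: "\<bar>W j p - W i p\<bar> \<le> 1" for i j p
    using W01[of i p] W01[of j p] by auto
  have W_L1: "(LINT p|?M2. \<bar>W j p - W i p\<bar>) \<le> sqrt \<bar>E j - E i\<bar>" for i j
  proof -
    have "(LINT p|?M2. (W j p - W i p)\<^sup>2) \<le> \<bar>E j - E i\<bar>"
    proof (cases "i \<le> j")
      case False
      then have "(LINT p|?M2. (W i p - W j p)\<^sup>2) = E i - E j"
        by (intro W_diff) simp
      then show ?thesis
        by (simp add: power2_commute)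
    qed (simp add: W_diff)
    then have "sqrt (LINT p|?M2. (W j p - W i p)\<^sup>2) \<le> sqrt \<bar>E j - E i\<bar>"
      by (rule real_sqrt_le_mono)
    moreover have "(LINT p|?M2. \<bar>W j p - W i p\<bar>) \<le> sqrt (LINT p|?M2. (W j p - W i p)\<^sup>2)"
      by (rule integral_abs_le_sqrt[OF _ W_le1]) simp
    ultimately show ?thesis
      by (rule order_trans[rotated])
  qed
  have E_mono: "E i \<le> E j" if "i \<le> j" for i j
    using W_diff[OF that] Bochner_Integration.integral_nonneg[of ?M2 "\<lambda>p. (W j p - W i p)\<^sup>2"] by simp
  have E_le1: "E i \<le> 1" for i
  proof -
    have "E i \<le> (LINT p|?M2. 1)"
      unfolding E_def using sq01 by (intro integral_mono integrable_unit_square_bounded[of _ 1]) auto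
    then show ?thesis
      using emeasure_unit_square by (simp add: measure_def space_restrict_space)
  qed
  obtain e where e: "E \<longlonglongrightarrow> e" "\<And>i. E i \<le> e"
    using incseq_convergent[of E 1] E_mono E_le1 by (auto simp: incseq_def)
  \<comment> \<open>Distances in mean are bounded by roots of energy gaps, so gaps below
    \<open>(1 / 4) ^ k\<close> give summable distances \<open>(1 / 2) ^ k\<close> along the levels
    \<open>s k\<close>.\<close>
  have "\<exists>i. e - E i < (1 / 4) ^ k" for k
  proof -
    have "e - (1 / 4) ^ k < e" by simp
    from order_tendstoD(1)[OF e(1) this] obtain i where "e - (1 / 4) ^ k < E i"
      using eventually_happens trivial_limit_sequentially by blast
    then show ?thesis
      by (intro exI[of _ i]) simp
  qed
  then obtain s where s: "\<And>k. e - E (s k) < (1 / 4) ^ k"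
    by metis
  have sqrt_pow: "sqrt ((1 / 4) ^ k) = (1 / 2) ^ k" for k
    by (simp add: real_sqrt_power real_sqrt_divide)
  have step: "(LINT p|?M2. \<bar>W (s (Suc k)) p - W (s k) p\<bar>) \<le> (1 / 2) ^ k" for k
  proof -
    have "(1 / 4 :: real) ^ Suc k \<le> (1 / 4) ^ k"
      by (intro power_decreasing) auto
    then have "\<bar>E (s (Suc k)) - E (s k)\<bar> \<le> (1 / 4) ^ k"
      using s[of k] s[of "Suc k"] e(2)[of "s k"] e(2)[of "s (Suc k)"] by linarith
    then have "sqrt \<bar>E (s (Suc k)) - E (s k)\<bar> \<le> sqrt ((1 / 4) ^ k)"
      by (rule real_sqrt_le_mono)
    then show ?thesis
      using W_L1[of "s (Suc k)" "s k"] by (simp only: sqrt_pow)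
  qed
  have Wint: "integrable ?M2 (W i)" for i
    using W01 by (intro integrable_unit_square_bounded[of _ 1]) auto
  have ae_conv: "AE p in ?M2. convergent (\<lambda>k. W (s k) p)"
    using Wint step by (rule AE_convergent_of_summable_L1) simp
  \<comment> \<open>Clamping bounds \<open>w\<close> also on the null set where the sequence
    diverges and \<open>lim\<close> is arbitrary. Symmetry survives there because reflected points
    have the same sequence.\<close>
  define w where "w p = max 0 (min 1 (lim (\<lambda>k. W (s k) p)))" for p
  have w01: "w p \<in> {0..1}" for p
    by (simp add: w_def)
  have wm [measurable]: "w \<in> borel_measurable ?M2"
    unfolding w_def by measurable
  have graphon_w: "graphon (\<lambda>x y. w (x, y))"
  proof -
    have "(\<lambda>k. W (s k) (x, y)) = (\<lambda>k. W (s k) (y, x))" for x y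
      by (intro ext W_sym)
    then have "w (x, y) = w (y, x)" for x y
      by (simp only: w_def)
    moreover have "(\<lambda>(x, y). w (x, y)) = w"
      by auto
    ultimately show ?thesis
      using wm w01 by (simp add: graphon_def)
  qed
  have "(\<lambda>k. LINT p|?M2. \<bar>W (s k) p - w p\<bar>) \<longlonglongrightarrow> (LINT p|?M2. 0)"
  proof (rule dominated)
    show "\<bar>\<bar>W (s k) p - w p\<bar>\<bar> \<le> 1" for k p
      using W01[of "s k" p] w01[of p] by auto
    show "AE p in ?M2. (\<lambda>k. \<bar>W (s k) p - w p\<bar>) \<longlonglongrightarrow> 0"
      using ae_conv
    proof eventually_elim
      case (elim p)
      then have lim: "(\<lambda>k. W (s k) p) \<longlonglongrightarrow> lim (\<lambda>k. W (s k) p)"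
        by (simp add: convergent_LIMSEQ_iff)
      then have "lim (\<lambda>k. W (s k) p) \<in> {0..1}"
        using W01 by (intro Lim_in_closed_set[OF closed_atLeastAtMost _ _ lim]) auto
      then have "w p = lim (\<lambda>k. W (s k) p)"
        by (simp add: w_def)
      then show ?case
        using lim tendsto_rabs_zero LIM_zero by metis
    qed
  qed auto
  then have Ww: "(\<lambda>k. LINT p|?M2. \<bar>W (s k) p - w p\<bar>) \<longlonglongrightarrow> 0"
    by simp
  have "(\<lambda>n. cut_norm (\<lambda>x y. V (r n) x y - w (x, y))) \<longlonglongrightarrow> 0"
  proof (rule tendstoI)
    fix \<epsilon> :: real assume \<epsilon>: "0 < \<epsilon>"
    have "(\<lambda>k. (1 / 2 :: real) ^ k) \<longlonglongrightarrow> 0"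
      by (intro LIMSEQ_realpow_zero) auto
    \<comment> \<open>Four errors below one fifth of \<open>\<epsilon>\<close> will be added: the
      root of the energy gap, the matrix error, and the distances of \<open>G n i\<close> to
      \<open>W i\<close> and of \<open>W i\<close> to \<open>w\<close>.\<close>
    from order_tendstoD(2)[OF this, of "\<epsilon> / 5"] order_tendstoD(2)[OF Ww, of "\<epsilon> / 5"] \<epsilon>
    have "\<forall>\<^sub>F k in sequentially. (1 / 2) ^ k < \<epsilon> / 5 \<and> (LINT p|?M2. \<bar>W (s k) p - w p\<bar>) < \<epsilon> / 5"
      by (intro eventually_conj) auto
    then obtain k where k: "(1 / 2) ^ k < \<epsilon> / 5" "(LINT p|?M2. \<bar>W (s k) p - w p\<bar>) < \<epsilon> / 5"
      using eventually_happens trivial_limit_sequentially by blast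
    define i where "i = s k"
    \<comment> \<open>The next energy does not exceed the limit \<open>e\<close>, so closeness of
      \<open>E i\<close> to \<open>e\<close> bounds the gap to the next level.\<close>
    have "E (Suc i) - E i \<le> (1 / 4) ^ k"
      using s[of k] e(2)[of "Suc i"] by (simp add: i_def)
    then have "sqrt (E (Suc i) - E i) \<le> sqrt ((1 / 4) ^ k)"
      by (rule real_sqrt_le_mono)
    then have "sqrt (E (Suc i) - E i) < \<epsilon> / 5"
      using k(1) unfolding sqrt_pow by (rule le_less_trans)
    then have ev1: "\<forall>\<^sub>F n in sequentially. sqrt ((LINT p|?M2. (G n (Suc i) p)\<^sup>2) - (LINT p|?M2. (G n i p)\<^sup>2)) < \<epsilon> / 5"
      by (intro order_tendstoD(2)[OF tendsto_real_sqrt[OF tendsto_diff[OF energy energy]]])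
    have "(\<lambda>n. LINT p|?M2. \<bar>G n i p - W i p\<bar>) \<longlonglongrightarrow> (LINT p|?M2. 0)"
    proof (rule dominated)
      show "\<bar>\<bar>G n i p - W i p\<bar>\<bar> \<le> 1" for n p
        using G01[of n i p] W01[of i p] by auto
      show "AE p in ?M2. (\<lambda>n. \<bar>G n i p - W i p\<bar>) \<longlonglongrightarrow> 0"
        using GW[of i] by eventually_elim (intro tendsto_rabs_zero LIM_zero)
    qed auto
    then have ev2: "\<forall>\<^sub>F n in sequentially. (LINT p|?M2. \<bar>G n i p - W i p\<bar>) < \<epsilon> / 5"
      using \<epsilon> by (intro order_tendstoD(2)) auto
    have "(\<lambda>n. inverse (real (Suc (r n)))) \<longlonglongrightarrow> 0"
      using LIMSEQ_subseq_LIMSEQ[OF LIMSEQ_inverse_real_of_nat r] by (simp add: o_def)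
    then have ev3: "\<forall>\<^sub>F n in sequentially. inverse (real (Suc (r n))) < \<epsilon> / 5"
      using \<epsilon> by (intro order_tendstoD(2)) auto
    show "\<forall>\<^sub>F n in sequentially. dist (cut_norm (\<lambda>x y. V (r n) x y - w (x, y))) 0 < \<epsilon>"
      using ev1 ev2 ev3 eventually_gt_at_top[of i]
    proof eventually_elim
      case (elim n)
      then have "i < r n"
        using seq_suble[OF r, of n] by linarith
      define v where "v = (\<lambda>(x, y). V (r n) x y)"
      have vm [measurable]: "v \<in> borel_measurable ?M2" and v01: "\<And>p. p \<in> ?I \<Longrightarrow> v p \<in> {0..1}"
        using version[of "r n"] by (auto simp: v_def version_of_def graphon_def)
      have int: "integrable ?M2 (\<lambda>p. v p - G n i p)" "integrable ?M2 (\<lambda>p. G n i p - W i p)" "integrable ?M2 (\<lambda>p. W i p - w p)"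
      proof -
        have "integrable ?M2 v" "integrable ?M2 (G n i)" "integrable ?M2 w"
          using v01 G01 w01 by (auto intro!: integrable_unit_square_bounded[of _ 1])
        then show "integrable ?M2 (\<lambda>p. v p - G n i p)" "integrable ?M2 (\<lambda>p. G n i p - W i p)" "integrable ?M2 (\<lambda>p. W i p - w p)"
          using Wint by auto
      qed
      \<comment> \<open>\<open>n\<close> is fixed before \<open>A\<close>, so the bound is uniform
        in \<open>A\<close> and carries over to the supremum.\<close>
      have "\<bar>LINT x:A|lebesgue. LINT y:A|lebesgue. V (r n) x y - w (x, y)\<bar> \<le> 4 * (\<epsilon> / 5)"
        if A: "A \<in> sets (lebesgue_on unit_ivl)" for A
      proof -
        let ?R = "\<lambda>f. LINT p|?M2. indicator A (fst p) * indicator A (snd p) * f p"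
        have ind: "integrable ?M2 (\<lambda>p. indicator A (fst p) * indicator A (snd p) * f p)"
          if "integrable ?M2 f" for f :: "_ \<Rightarrow> real"
          using that indicator_rectangle_measurable[OF A]
          by (intro Bochner_Integration.integrable_bound[OF that]) (auto simp: indicator_def intro!: AE_I2)
        have "(LINT x:A|lebesgue. LINT y:A|lebesgue. V (r n) x y - w (x, y)) = ?R (\<lambda>p. v p - w p)"
        proof -
          have "\<bar>v p - w p\<bar> \<le> 1" if "p \<in> ?I" for p
            using v01[OF that] w01[of p] by auto
          then have "(LINT x:A|lebesgue. LINT y:A|lebesgue. v (x, y) - w (x, y)) = ?R (\<lambda>p. v p - w p)"
            by (intro iterated_integral_unit_square[where F = "\<lambda>p. v p - w p" and B = 1] borel_measurable_diff vm wm A)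
          then show ?thesis
            by (simp add: v_def)
        qed
        also have "\<dots> = (LINT p|?M2. indicator A (fst p) * indicator A (snd p) * (v p - G n i p) +
            indicator A (fst p) * indicator A (snd p) * (G n i p - W i p) +
            indicator A (fst p) * indicator A (snd p) * (W i p - w p))"
          by (intro Bochner_Integration.integral_cong refl) (simp add: algebra_simps)
        also have "\<dots> = ?R (\<lambda>p. v p - G n i p) + ?R (\<lambda>p. G n i p - W i p) + ?R (\<lambda>p. W i p - w p)"
          using ind[OF int(1)] ind[OF int(2)] ind[OF int(3)] by simp
        finally have split: "(LINT x:A|lebesgue. LINT y:A|lebesgue. V (r n) x y - w (x, y)) =
          ?R (\<lambda>p. v p - G n i p) + ?R (\<lambda>p. G n i p - W i p) + ?R (\<lambda>p. W i p - w p)" .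
        have "\<bar>?R (\<lambda>p. v p - G n i p)\<bar> \<le> 2 * (\<epsilon> / 5)"
          using reg[OF \<open>i < r n\<close> A] elim(1,3) unfolding v_def G_def by linarith
        moreover have "\<bar>?R (\<lambda>p. G n i p - W i p)\<bar> \<le> \<epsilon> / 5"
          using rectangle_integral_le[OF int(2) A] elim(2) by linarith
        moreover have "\<bar>?R (\<lambda>p. W i p - w p)\<bar> \<le> \<epsilon> / 5"
          using rectangle_integral_le[OF int(3) A] k(2) unfolding i_def by linarith
        ultimately show ?thesis
          unfolding split by linarith
      qed
      then have "\<bar>cut_norm (\<lambda>x y. V (r n) x y - w (x, y))\<bar> \<le> 4 * (\<epsilon> / 5)"
        by (rule abs_cut_norm_le)
      then show ?case
        using \<epsilon> by (simp add: dist_real_def)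
    qed
  qed
  then show ?thesis
    using r version graphon_w by (intro exI[of _ r] exI[of _ "\<lambda>n. V (r n)"] exI[of _ "\<lambda>x y. w (x, y)"]) auto
qed

end
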